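(* Let $H$ be an $\mathcal{L}_2$-stable LTI system with stabilizable and detectable realization $(A,B,C,D)$, with $m$ states, $n$ inputs and $n$ outputs, and let $\Pi=\begin{bmatrix}a&b\\ b&c\end{bmatrix}$, $a,b,c\in\mathbb{R}$, be positive-negative. Let $$\varrho(\Pi)=\begin{bmatrix}C&D\\ 0&I\end{bmatrix}^\top(\Pi\otimes I_n)\begin{bmatrix}C&D\\ 0&I\end{bmatrix}.$$ If there exists a real symmetric matrix $P=P^\top\in\mathbb{R}^{m\times m}$ satisfying $$\begin{bmatrix}A&B\\ I&0\end{bmatrix}^\top\begin{bmatrix}0&P\\ P&0\end{bmatrix}\begin{bmatrix}A&B\\ I&0\end{bmatrix}-\varrho(\Pi)\preceq0,$$ then $\mathrm{SG}(H)\subset\mathcal{S}(\Pi)$ and $\mathrm{SG}_e(H)\subset\mathcal{S}(\Pi)$.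
   Context: The LTI system is $\dot x=Ax+Bu$, $y=Cx+Du$, $x(0)=0$, with $x(t)\in\mathbb{R}^m$ and $u(t),y(t)\in\mathbb{R}^n$; its transfer function is $H(s)=C(sI-A)^{-1}B+D$, and it is $\mathcal{L}_2$-stable if $\|H\|_\infty:=\sup_\omega\bar\sigma(H(\mathrm{j}\omega))<\infty$, understood in the usual sense that $H(s)$ has no poles in the closed right half-plane and so $H$ maps $\mathcal{L}_2^n$ to itself with finite gain. $\mathcal{L}_2^n$ is the space of square-integrable signals $u:\mathbb{R}_{\ge 0}\to\mathbb{R}^n$ with inner product $\langle u,y\rangle=\int_0^\infty u(t)^\top y(t)\,dt$ and norm $\|u\|^2=\langle u,u\rangle$. $\mathcal{P}_T$ denotes truncation to $[0,T]$, and $\mathcal{L}_{2e}^n$ is the space of signals $u$ with $\mathcal{P}_Tu\in\mathcal{L}_2^n$ for all $T\ge0$. For $u,y\in\mathcal{L}_2^n$, $u\ne0$, let $\rho(u,y)=\|y\|/\|u\|$ and $\theta(u,y)=\arccos\!\big(\langle u,y\rangle/(\|u\|\|y\|)\big)$, with $\theta(u,y)=0$ if $y=0$. The soft scaled graph is $\mathrm{SG}(H)=\{\rho(u,y)e^{\pm \mathrm{j}\theta(u,y)}: u\in\mathcal{L}_2^n\setminus\{0\},\ y=Hu\}$. The hard scaled graph is $\mathrm{SG}_e(H)=\{\rho(\mathcal{P}_Tu,\mathcal{P}_Ty)e^{\pm \mathrm{j}\theta(\mathcal{P}_Tu,\mathcal{P}_Ty)}: u\in\mathcal{L}_{2e}^n,\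 y=Hu,\ T>0,\ \mathcal{P}_Tu\ne0\}$. $\mathcal{S}(\Pi)=\{z\in\mathbb{C}: a|z|^2+2b\,\mathrm{Re}\{z\}+c\ge0\}$. $\Pi$ is positive-negative if there is $\varepsilon>0$ with $c\ge\varepsilon$ and $a\le-\varepsilon$. $\otimes$ is the Kronecker product and $\preceq0$ means negative semidefinite. *)

theory Defs
  imports "HOL-Complex_Analysis.Complex_Analysis"
begin

unbundle no fps_syntax

section \<open>Matrices\<close>

definition eigval :: "complex^'k^'k \<Rightarrow> complex \<Rightarrow> bool" where
  "eigval M l \<longleftrightarrow> (\<exists>v. v \<noteq> 0 \<and> M *v v = l *s v)"

definition hurwitz :: "real^'k^'k \<Rightarrow> bool" where
  "hurwitz M \<longleftrightarrow> (\<forall>l. eigval (map_matrix complex_of_real M) l \<longrightarrow> Re l < 0)"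

definition stabilizable :: "real^'m^'m \<Rightarrow> real^'n^'m \<Rightarrow> bool" where
  "stabilizable A B \<longleftrightarrow> (\<exists>K :: real^'m^'n. hurwitz (A + B ** K))"

definition detectable :: "real^'m^'m \<Rightarrow> real^'m^'n \<Rightarrow> bool" where
  "detectable A C \<longleftrightarrow> (\<exists>L :: real^'n^'m. hurwitz (A + L ** C))"

definition conj_transpose :: "complex^'c^'r \<Rightarrow> complex^'r^'c" where
  "conj_transpose M = map_matrix cnj (transpose M)"

definition max_singular_value :: "complex^'c^'r \<Rightarrow> real" where
  "max_singular_value M =
     sqrt (Max {l :: real. eigval (conj_transpose M ** M) (complex_of_real l)})"

definition neg_semidef :: "real^'k^'k \<Rightarrow> bool" where
  "neg_semidef M \<longleftrightarrow> transpose M = M \<and> (\<forall>v. v \<bullet> (M *v v) \<le> 0)"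

text \<open>The block matrix with first block row \<open>(M N)\<close> and second block row \<open>(K L)\<close>;
  rows and columns are indexed by sum types.\<close>

definition block :: "real^'c^'r \<Rightarrow> real^'d^'r \<Rightarrow> real^'c^'s \<Rightarrow> real^'d^'s
    \<Rightarrow> real^('c + 'd)^('r + 's)" where
  "block M N K L = (\<chi> i j.
     (case i of
        Inl i' \<Rightarrow> (case j of Inl j' \<Rightarrow> M $ i' $ j' | Inr j' \<Rightarrow> N $ i' $ j')
      | Inr i' \<Rightarrow> (case j of Inl j' \<Rightarrow> K $ i' $ j' | Inr j' \<Rightarrow> L $ i' $ j')))"

definition kronecker :: "real^'c^'r \<Rightarrow> real^'d^'s \<Rightarrow> real^('c \<times> 'd)^('r \<times> 's)" where
  "kronecker M N = (\<chi> p q. M $ fst p $ fst q * N $ snd p $ snd q)"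

text \<open>A Kronecker product with a 2-by-2 left factor has rows and columns indexed by
  \<open>2 \<times> 'n\<close>; to multiply it with block matrices it is reindexed along the
  order-preserving bijection from \<open>'n + 'n\<close>.\<close>

definition half_index :: "'n + 'n \<Rightarrow> 2 \<times> 'n" where
  "half_index p = (case p of Inl i \<Rightarrow> (1, i) | Inr i \<Rightarrow> (2, i))"

definition kronecker_id :: "real^2^2 \<Rightarrow> real^('n::finite + 'n)^('n + 'n)" where
  "kronecker_id M =
     (\<chi> p q. kronecker M (mat 1 :: real^'n::finite^'n) $ half_index p $ half_index q)"

lemma kronecker_id_block:
  "kronecker_id M = block (mat (M $ 1 $ 1)) (mat (M $ 1 $ 2)) (mat (M $ 2 $ 1)) (mat (M $ 2 $ 2))"
  by (auto simp: kronecker_id_def kronecker_def half_index_def block_def mat_def vec_eq_iff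
      split: sum.splits)


section \<open>Multipliers\<close>

definition multiplier :: "real \<Rightarrow> real \<Rightarrow> real \<Rightarrow> real^2^2" where
  "multiplier a b c = vector [vector [a, b], vector [b, c]]"

definition positive_negative :: "real^2^2 \<Rightarrow> bool" where
  "positive_negative M \<longleftrightarrow> (\<exists>\<epsilon>>0. M $ 2 $ 2 \<ge> \<epsilon> \<and> M $ 1 $ 1 \<le> - \<epsilon>)"

definition multiplier_region :: "real^2^2 \<Rightarrow> complex set" where
  "multiplier_region M =
     {z. M $ 1 $ 1 * (cmod z)\<^sup>2 + 2 * M $ 1 $ 2 * Re z + M $ 2 $ 2 \<ge> 0}"

definition varrho :: "real^'m^'n \<Rightarrow> real^'n^'n \<Rightarrow> real^2^2 \<Rightarrow> real^('m + 'n)^('m + 'n)" where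
  "varrho C D M =
     transpose (block C D 0 (mat 1)) ** kronecker_id M ** block C D 0 (mat 1)"


section \<open>Signals\<close>

text \<open>Signals on the half-line are functions on the reals whose values at negative times are
  ignored. Elements of $L_2$ are represented by functions rather than by classes modulo
  null sets, so being nonzero is expressed by the norm.\<close>

type_synonym 'n signal = "real \<Rightarrow> real^'n"

definition L2 :: "'n::finite signal set" where
  "L2 = {u. set_borel_measurable lebesgue {0..} u \<and>
            set_integrable lebesgue {0..} (\<lambda>t. (norm (u t))\<^sup>2)}"

definition sig_inner :: "'n::finite signal \<Rightarrow> 'n signal \<Rightarrow> real" where
  "sig_inner u y = (LINT t:{0..}|lebesgue. u t \<bullet> y t)"

definition sig_norm :: "'n::finite signal \<Rightarrow> real" where
  "sig_norm u = sqrt (sig_inner u u)"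

definition trunc :: "real \<Rightarrow> 'n::finite signal \<Rightarrow> 'n signal" where
  "trunc T u = (\<lambda>t. if t \<in> {0..T} then u t else 0)"

definition L2e :: "'n::finite signal set" where
  "L2e = {u. \<forall>T\<ge>0. trunc T u \<in> L2}"


section \<open>Scaled graphs\<close>

definition gain :: "'n::finite signal \<Rightarrow> 'n signal \<Rightarrow> real" where
  "gain u y = sig_norm y / sig_norm u"

definition phase :: "'n::finite signal \<Rightarrow> 'n signal \<Rightarrow> real" where
  "phase u y =
     (if sig_norm y = 0 then 0 else arccos (sig_inner u y / (sig_norm u * sig_norm y)))"

definition sg_points :: "'n::finite signal \<Rightarrow> 'n signal \<Rightarrow> complex set" where
  "sg_points u y =
     {complex_of_real (gain u y) * exp (\<i> * complex_of_real (phase u y)),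
      complex_of_real (gain u y) * exp (- \<i> * complex_of_real (phase u y))}"

text \<open>A system is represented by its graph, \<open>H u y\<close> meaning that \<open>y\<close> is the output for
  the input \<open>u\<close>.\<close>

definition SG :: "('n::finite signal \<Rightarrow> 'n signal \<Rightarrow> bool) \<Rightarrow> complex set" where
  "SG H = {z. \<exists>u y. u \<in> L2 \<and> sig_norm u \<noteq> 0 \<and> H u y \<and> z \<in> sg_points u y}"

definition SGe :: "('n::finite signal \<Rightarrow> 'n signal \<Rightarrow> bool) \<Rightarrow> complex set" where
  "SGe H = {z. \<exists>u y T. u \<in> L2e \<and> H u y \<and> T > 0 \<and> sig_norm (trunc T u) \<noteq> 0 \<and>
                       z \<in> sg_points (trunc T u) (trunc T y)}"


section \<open>LTI systems\<close>

text \<open>Inputs are only measurable, so the state equation with \<open>x(0) = 0\<close> is stated in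
  integrated (Caratheodory) form.\<close>

definition lti :: "real^'m^'m \<Rightarrow> real^'n^'m \<Rightarrow> real^'m^'n \<Rightarrow> real^'n^'n
    \<Rightarrow> 'n::finite signal \<Rightarrow> 'n signal \<Rightarrow> bool" where
  "lti A B C D u y \<longleftrightarrow>
     (\<exists>x :: real \<Rightarrow> real^'m.
        (\<forall>t\<ge>0. ((\<lambda>s. A *v x s + B *v u s) has_integral x t) {0..t}) \<and>
        (\<forall>t\<ge>0. y t = C *v x t + D *v u t))"

definition transfer_function :: "real^'m^'m \<Rightarrow> real^'n^'m \<Rightarrow> real^'m^'n \<Rightarrow> real^'n^'n
    \<Rightarrow> complex \<Rightarrow> complex^'n^'n" where
  "transfer_function A B C D s =
     map_matrix complex_of_real C ** matrix_inv (mat s - map_matrix complex_of_real A)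
       ** map_matrix complex_of_real B + map_matrix complex_of_real D"

text \<open>Poles are read off from the behaviour near a point, so the unspecified values of
  \<open>matrix_inv\<close> at eigenvalues of \<open>A\<close> do not matter.\<close>

definition L2_stable :: "real^'m^'m \<Rightarrow> real^'n^'m \<Rightarrow> real^'m^'n \<Rightarrow> real^'n^'n \<Rightarrow> bool" where
  "L2_stable A B C D \<longleftrightarrow>
     (\<forall>s i j. Re s \<ge> 0 \<longrightarrow> \<not> is_pole (\<lambda>z. transfer_function A B C D z $ i $ j) s) \<and>
     bdd_above (range (\<lambda>\<omega> :: real.
       max_singular_value (transfer_function A B C D (\<i> * complex_of_real \<omega>))))"

end

theory Submission
  imports Defs "HOL-Computational_Algebra.Fundamental_Theorem_Algebra"
begin

unbundle no fps_syntax

text \<open>Along trajectories the linear matrix inequality bounds \<open>x(T) \<bullet> P x(T)\<close> by the integral over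
  \<open>[0, T]\<close> of the supply rate \<open>a |y|\<^sup>2 + 2 b u \<bullet> y + c |u|\<^sup>2\<close>. A stabilizable and detectable
  realization of a stable transfer function has a Hurwitz matrix \<open>A\<close>, and since \<open>a < 0\<close> the inequality
  with \<open>u = 0\<close> says that \<open>x \<bullet> P x\<close> decays along the flow of \<open>A\<close>, which forces \<open>P\<close> to be positive
  semidefinite. So the integrated supply rate is nonnegative for every \<open>T\<close>, which is membership of the
  hard scaled graph in the region. Moreover \<open>a < 0\<close> then bounds the energy of \<open>y\<close> by that of \<open>u\<close>,
  so \<open>T\<close> may tend to infinity, giving the soft scaled graph without any decay of \<open>x\<close>.\<close>

section \<open>Transfer functions and internal stability\<close>

text \<open>\<open>P\<close> is only symmetric, and for zero input its form decreases only weakly,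
  so \<open>P\<close> is not itself a Lyapunov matrix of \<open>A\<close>. The usual argument for
  its sign follows the free motion \<open>exp (t A) x\<close> to zero. Here no matrix exponential
  appears: \<open>P\<close> is compared with a strict Lyapunov matrix \<open>Q\<close>, and
  \<open>Q\<close> is obtained by linear algebra alone. Stability is given through the transfer
  function, in which an unstable mode of \<open>A\<close> could cancel; stabilizability and
  detectability exclude this. The remaining obstacle is analytic: inputs are merely square
  integrable, so the storage function cannot be handled by the classical chain rule, and its
  increment is computed by a product rule in integrated form.\<close>

lemma norm_vector_scalar_mult: "norm (z *s v) = cmod z * norm v" for v :: "complex^'k"
  unfolding norm_vec_def by (simp add: norm_mult L2_set_right_distrib)

text \<open>The constant depends on the matrix only through its entries, so one bound serves all
  values of the transfer function near a point.\<close>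

lemma matrix_vector_mult_bounded_by_entries:
  fixes M :: "complex^'k^'l"
  assumes "\<And>i j. cmod (M $ i $ j) \<le> c"
  shows "norm (M *v v) \<le> real CARD('l) * real CARD('k) * c * norm v"
proof -
  have c: "0 \<le> c" using norm_ge_zero order_trans[OF _ assms] by blast
  have "norm ((M *v v) $ i) \<le> real CARD('k) * c * norm v" for i
  proof -
    have "norm ((M *v v) $ i) \<le> (\<Sum>j\<in>UNIV. cmod (M $ i $ j * v $ j))"
      by (simp add: matrix_vector_mult_def norm_sum)
    also have "\<dots> \<le> (\<Sum>j\<in>(UNIV::'k set). c * norm v)"
      unfolding norm_mult
      using c by (intro sum_mono mult_mono assms Finite_Cartesian_Product.norm_nth_le) auto
    finally show ?thesis by (simp add: mult.assoc)
  qed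
  then have "(\<Sum>i\<in>UNIV. norm ((M *v v) $ i)) \<le> (\<Sum>i\<in>(UNIV::'l set). real CARD('k) * c * norm v)"
    by (intro sum_mono) auto
  moreover have "norm (M *v v) \<le> (\<Sum>i\<in>UNIV. norm ((M *v v) $ i))"
    unfolding norm_vec_def by (rule L2_set_le_sum) auto
  ultimately show ?thesis by (simp add: mult.assoc)
qed

lemma matrix_vector_mult_bounded:
  fixes M :: "complex^'k^'l"
  obtains c where "c > 0" "\<And>v. norm (M *v v) \<le> c * norm v"
proof -
  obtain c where "c > 0" "\<forall>v. norm (M *v v) \<le> norm v * c"
    using bounded_linear.pos_bounded[OF matrix_vector_mul_bounded_linear[of M]] by blast
  then show thesis by (intro that[of c]) (auto simp: mult.commute)
qed

lemma matrix_inv_left: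
  assumes "invertible X"
  shows "matrix_inv X ** X = mat 1"
  using assms someI_ex[of "\<lambda>Y. X ** Y = mat 1 \<and> Y ** X = mat 1"]
  unfolding invertible_def matrix_inv_def by blast

lemma matrix_inv_right:
  assumes "invertible X"
  shows "X ** matrix_inv X = mat 1"
  using assms someI_ex[of "\<lambda>Y. X ** Y = mat 1 \<and> Y ** X = mat 1"]
  unfolding invertible_def matrix_inv_def by blast

lemma mat_vector_mult: "mat s *v v = s *s v" for v :: "'a::comm_semiring_1^'k"
  by (simp add: vec_eq_iff matrix_vector_mult_def mat_def if_distrib[where f="\<lambda>x. x * _"] cong: if_cong)

abbreviation complexify :: "real^'c^'r \<Rightarrow> complex^'c^'r" where
  "complexify \<equiv> map_matrix complex_of_real"

lemma complexify_add: "complexify (M + N) = complexify M + complexify N"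
  by (simp add: vec_eq_iff)

lemma complexify_mult: "complexify (M ** N) = complexify M ** complexify N"
  by (simp add: vec_eq_iff matrix_matrix_mult_def)

text \<open>Injectivity of \<open>l - M\<close> gives a lower bound \<open>e\<close>, and moving
  \<open>s\<close> by less than \<open>e/2\<close> costs at most half of it. So \<open>d\<close> is
  both the radius and the bound: the resolvent is bounded uniformly near \<open>l\<close>.\<close>

lemma not_eigval_bounded_below:
  fixes M :: "complex^'k^'k"
  assumes "\<not> eigval M l"
  obtains d where "d > 0" "\<And>s v. cmod (s - l) < d \<Longrightarrow> d * norm v \<le> norm (s *s v - M *v v)"
proof -
  let ?f = "\<lambda>v. l *s v - M *v v"
  have eq: "?f = (\<lambda>v. (mat l - M) *v v)"
    by (simp add: matrix_vector_mult_diff_rdistrib mat_vector_mult)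
  have lin: "linear ?f" unfolding eq by simp
  have "inj ?f"
    unfolding linear_injective_0[OF lin] using assms by (auto simp: eigval_def)
  then obtain e where e: "e > 0" "\<And>v. e * norm v \<le> norm (?f v)"
    using linear_inj_bounded_below_pos[OF lin] by blast
  show thesis
  proof (rule that[of "e/2"])
    fix s v assume s: "cmod (s - l) < e/2"
    have "?f v = (s *s v - M *v v) - (s - l) *s v"
      by (simp add: vector_sub_rdistrib algebra_simps)
    then have "norm (?f v) \<le> norm (s *s v - M *v v) + cmod (s - l) * norm v"
      by (metis norm_triangle_ineq4 norm_vector_scalar_mult)
    also have "\<dots> \<le> norm (s *s v - M *v v) + e/2 * norm v"
      using s by (intro add_left_mono mult_right_mono) auto
    finally show "e/2 * norm v \<le> norm (s *s v - M *v v)"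
      using e(2)[of v] by (simp add: field_simps)
  qed (use e in auto)
qed

section \<open>Entries of the transfer function near a point\<close>

lemma det_analytic_on:
  fixes X :: "complex \<Rightarrow> complex^'k^'k"
  assumes "\<And>i j. (\<lambda>s. X s $ i $ j) analytic_on S"
  shows "(\<lambda>s. det (X s)) analytic_on S"
  unfolding det_def by (intro analytic_intros assms)

text \<open>Cramer's rule for column \<open>j\<close> of the inverse. It turns the resolvent into
  quotients of determinants, which depend analytically on \<open>s\<close>.\<close>

lemma matrix_inv_entry:
  fixes X :: "'a::field^'k^'k"
  assumes "det X \<noteq> 0"
  shows "matrix_inv X $ i $ j = det (\<chi> r c. if c = i then axis j 1 $ r else X $ r $ c) / det X"
proof -
  have "X ** matrix_inv X = mat 1"
    using assms by (simp add: invertible_det_nz matrix_inv_right)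
  then have "X *v (matrix_inv X *v axis j 1) = axis j 1"
    by (simp add: matrix_vector_mul_assoc)
  then have "matrix_inv X *v axis j 1 =
      (\<chi> k. det (\<chi> r c. if c = k then axis j 1 $ r else X $ r $ c) / det X)"
    using cramer[OF assms] by blast
  moreover have "(matrix_inv X *v axis j 1) $ i = matrix_inv X $ i $ j"
    by (simp add: matrix_vector_mult_def axis_def if_distrib[where f="\<lambda>x. _ * x"] cong: if_cong)
  ultimately show ?thesis by simp
qed

text \<open>The determinant is an entire function of \<open>s\<close>. It is not identically zero,
  since a number beyond the operator norm of \<open>M\<close> is no eigenvalue, so its zeros are
  isolated.\<close>

lemma det_resolvent_nonzero:
  fixes M :: "complex^'k^'k"
  shows "eventually (\<lambda>s. det (mat s - M) \<noteq> 0) (at l)"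
proof -
  obtain c where c: "c > 0" "\<And>v. norm (M *v v) \<le> c * norm v"
    using matrix_vector_mult_bounded[of M] by blast
  define b where "b = complex_of_real (2 * c)"
  have "\<exists>x. x \<noteq> 0 \<and> (mat b - M) *v x = 0" if "det (mat b - M) = 0"
    using that by (metis matrix_left_invertible_ker invertible_det_nz invertible_left_inverse)
  moreover have False if x: "x \<noteq> 0" "(mat b - M) *v x = 0" for x
  proof -
    have "M *v x = b *s x"
      using x(2) by (simp add: matrix_vector_mult_diff_rdistrib mat_vector_mult)
    then have "norm (M *v x) = 2 * c * norm x"
      using c(1) by (simp only: norm_vector_scalar_mult b_def norm_of_real)
    with c(2)[of x] c(1) x show False by simp
  qed
  ultimately have nz: "det (mat b - M) \<noteq> 0" by blast
  have "(\<lambda>s. det (mat s - M)) analytic_on UNIV"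
  proof (rule det_analytic_on)
    show "(\<lambda>s. (mat s - M) $ i $ j) analytic_on UNIV" for i j
      by (cases "i = j") (auto simp: mat_def intro!: analytic_intros)
  qed
  then have "(\<lambda>s. det (mat s - M)) holomorphic_on UNIV"
    by (rule analytic_imp_holomorphic)
  from non_zero_neighbour_alt[OF this open_UNIV connected_UNIV UNIV_I UNIV_I nz, of l]
  show ?thesis by simp
qed

text \<open>The entry agrees with a rational expression only on a punctured neighbourhood of
  \<open>l\<close>, since \<open>matrix_inv\<close> is unspecified at an eigenvalue. Being
  meromorphic does not depend on the value at \<open>l\<close>.\<close>

lemma transfer_function_meromorphic:
  "(\<lambda>s. transfer_function A B C D s $ i $ j) meromorphic_on {l}"
proof -
  let ?A = "complexify A"
  define R where "R k q s = det (\<chi> r c. if c = k then axis q 1 $ r else (mat s - ?A) $ r $ c)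
      / det (mat s - ?A)" for k q s
  have ana: "(\<lambda>s. (mat s - ?A) $ r $ c) analytic_on {l}" for r c
    by (cases "r = c") (auto simp: mat_def intro!: analytic_intros)
  have "(\<lambda>s. (\<chi> r c. if c = k then axis q 1 $ r else (mat s - ?A) $ r $ c) $ i $ j)
      analytic_on {l}" for k q i j
    using ana[of i j] by (cases "j = k") auto
  then have R: "R k q meromorphic_on {l}" for k q
    unfolding R_def
    by (intro meromorphic_intros analytic_on_imp_meromorphic_on det_analytic_on ana)
  have "eventually (\<lambda>s. transfer_function A B C D s $ i $ j =
      (\<Sum>q\<in>UNIV. (\<Sum>k\<in>UNIV. of_real (C $ i $ k) * R k q s) * of_real (B $ q $ j))
        + of_real (D $ i $ j)) (at l)"
    using det_resolvent_nonzero[of ?A l]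
  proof eventually_elim
    case (elim s)
    then have "matrix_inv (mat s - ?A) $ k $ q = R k q s" for k q
      unfolding R_def by (rule matrix_inv_entry)
    then show ?case
      by (simp add: transfer_function_def matrix_matrix_mult_def)
  qed
  then have "((\<lambda>s. transfer_function A B C D s $ i $ j) meromorphic_on {l}) \<longleftrightarrow>
     ((\<lambda>s. (\<Sum>q\<in>UNIV. (\<Sum>k\<in>UNIV. of_real (C $ i $ k) * R k q s) * of_real (B $ q $ j))
        + of_real (D $ i $ j)) meromorphic_on {l})"
    by (intro meromorphic_on_cong) auto
  then show ?thesis
    using R by (auto intro!: meromorphic_intros)
qed

text \<open>A meromorphic function without a pole at \<open>l\<close> has a finite limit there;
  finitely many entries then share one bound.\<close>

lemma transfer_function_bounded_near:
  assumes "L2_stable A B C D" "Re l \<ge> 0"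
  obtains c where
    "eventually (\<lambda>s. \<forall>i j. cmod (transfer_function A B C D s $ i $ j) \<le> c) (at l)"
proof -
  have "\<exists>c. eventually (\<lambda>s. cmod (transfer_function A B C D s $ i $ j) \<le> c) (at l)" for i j
  proof -
    have "not_essential (\<lambda>s. transfer_function A B C D s $ i $ j) l"
      using transfer_function_meromorphic meromorphic_at_iff by blast
    then obtain x where "((\<lambda>s. transfer_function A B C D s $ i $ j) \<longlongrightarrow> x) (at l)"
      using assms by (auto simp: not_essential_def L2_stable_def)
    then have "((\<lambda>s. cmod (transfer_function A B C D s $ i $ j)) \<longlongrightarrow> cmod x) (at l)"
      by (rule tendsto_norm)
    then have "eventually (\<lambda>s. cmod (transfer_function A B C D s $ i $ j) < cmod x + 1) (at l)"
      by (rule order_tendstoD) simp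
    then show ?thesis by (auto elim!: eventually_mono intro: less_imp_le)
  qed
  then obtain f where f:
    "\<And>i j. eventually (\<lambda>s. cmod (transfer_function A B C D s $ i $ j) \<le> f i j) (at l)"
    by metis
  have le: "f i j \<le> (\<Sum>i\<in>UNIV. \<Sum>j\<in>UNIV. \<bar>f i j\<bar>)" for i j
  proof -
    have "f i j \<le> \<bar>f i j\<bar>" by simp
    also have "\<dots> \<le> (\<Sum>j\<in>UNIV. \<bar>f i j\<bar>)"
      by (rule member_le_sum) auto
    also have "\<dots> \<le> (\<Sum>i\<in>UNIV. \<Sum>j\<in>UNIV. \<bar>f i j\<bar>)"
      by (rule member_le_sum[where f="\<lambda>i. \<Sum>j\<in>UNIV. \<bar>f i j\<bar>"]) (auto intro: sum_nonneg)
    finally show ?thesis .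
  qed
  have "eventually (\<lambda>s. \<forall>i j. cmod (transfer_function A B C D s $ i $ j) \<le> f i j) (at l)"
    using f by (intro eventually_all_finite) auto
  then show thesis
    by (intro that) (auto elim!: eventually_mono intro: order_trans[OF _ le])
qed

text \<open>At an eigenvector \<open>v\<close> for \<open>l\<close> the resolvent \<open>R\<close> gives \<open>R v = v / (s - l)\<close>, which blows up. With
  \<open>(s - A - B K) w = v\<close> one has \<open>R v = w - R B K w\<close>, so \<open>C R v\<close> is bounded because \<open>C R B\<close> has no
  pole at \<open>l\<close>; then \<open>(s - A - L C) R v = v - L C R v\<close> bounds \<open>R v\<close> itself.\<close>

lemma hurwitz_if_L2_stable:
  fixes A :: "real^'m^'m" and B :: "real^'n^'m" and C :: "real^'m^'n" and D :: "real^'n^'n"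
  assumes "L2_stable A B C D" "stabilizable A B" "detectable A C"
  shows "hurwitz A"
  unfolding hurwitz_def
proof (intro allI impI, rule ccontr)
  fix l assume "eigval (complexify A) l" and "\<not> Re l < 0"
  then have l: "Re l \<ge> 0" by simp
  obtain v where v: "v \<noteq> 0" "complexify A *v v = l *s v"
    using \<open>eigval _ l\<close> by (auto simp: eigval_def)
  obtain K L where K: "hurwitz (A + B ** K)" and L: "hurwitz (A + L ** C)"
    using assms by (auto simp: stabilizable_def detectable_def)
  define A' B' C' K' L' where defs: "A' = complexify A" "B' = complexify B" "C' = complexify C"
    "K' = complexify K" "L' = complexify L"
  have "\<not> eigval (A' + B' ** K') l"
    using K l unfolding hurwitz_def defs complexify_add complexify_mult by (meson not_less)
  then obtain d where d: "d > 0"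
    "\<And>s v. cmod (s - l) < d \<Longrightarrow> d * norm v \<le> norm (s *s v - (A' + B' ** K') *v v)"
    using not_eigval_bounded_below by blast
  have "\<not> eigval (A' + L' ** C') l"
    using L l unfolding hurwitz_def defs complexify_add complexify_mult by (meson not_less)
  then obtain e where e: "e > 0"
    "\<And>s v. cmod (s - l) < e \<Longrightarrow> e * norm v \<le> norm (s *s v - (A' + L' ** C') *v v)"
    using not_eigval_bounded_below by blast
  obtain c where c: "eventually (\<lambda>s. \<forall>i j. cmod (transfer_function A B C D s $ i $ j) \<le> c) (at l)"
    using transfer_function_bounded_near[OF assms(1) l] by blast
  obtain cC where cC: "cC > 0" "\<And>v. norm (C' *v v) \<le> cC * norm v"
    using matrix_vector_mult_bounded[of "C'"] by blast
  obtain cK where cK: "cK > 0" "\<And>v. norm (K' *v v) \<le> cK * norm v"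
    using matrix_vector_mult_bounded[of "K'"] by blast
  obtain cL where cL: "cL > 0" "\<And>v. norm (L' *v v) \<le> cL * norm v"
    using matrix_vector_mult_bounded[of "L'"] by blast
  obtain cD where cD: "cD > 0" "\<And>v. norm (complexify D *v v) \<le> cD * norm v"
    using matrix_vector_mult_bounded[of "complexify D"] by blast
  define N where "N = real CARD('n) * real CARD('n) * \<bar>c\<bar>"
  have N: "N \<ge> 0" by (simp add: N_def)
  \<comment> \<open>\<open>w0\<close> bounds the solution \<open>w\<close> of
    \<open>(s - A' - B' K') w = v\<close>. Then \<open>K' w\<close> is at most
    \<open>cK * w0\<close>, and \<open>C' x\<close> for \<open>x = v / (s - l)\<close> is at most
    \<open>cC * w0 + (N + cD) * (cK * w0)\<close>, where \<open>N + cD\<close> bounds transfer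
    function minus \<open>D\<close>. The lower bound \<open>e\<close> for
    \<open>s - A' - L' C'\<close> then gives \<open>bound\<close>, which does not depend on
    \<open>s\<close>.\<close>
  define w0 where "w0 = norm v / d"
  define bound where "bound = (norm v + cL * (cC * w0 + (N + cD) * (cK * w0))) / e"
  have ev: "eventually (\<lambda>s. norm v / cmod (s - l) \<le> bound) (at l)"
  proof -
    have "eventually (\<lambda>s. cmod (s - l) < d) (at l)" "eventually (\<lambda>s. cmod (s - l) < e) (at l)"
      using d(1) e(1) by (auto simp: eventually_at dist_norm)
    moreover have "eventually (\<lambda>s. s \<noteq> l) (at l)"
      by (simp add: eventually_at_filter)
    ultimately show ?thesis
      using c det_resolvent_nonzero[of A' l]
    proof eventually_elim
      case (elim s)
      define R where "R = matrix_inv (mat s - A')"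
      have R: "R ** (mat s - A') = mat 1"
        unfolding R_def using elim(5) by (simp add: invertible_det_nz matrix_inv_left)
      have Rv: "R *v (s *s z - A' *v z) = z" for z
      proof -
        have "s *s z - A' *v z = (mat s - A') *v z"
          by (simp add: matrix_vector_mult_diff_rdistrib mat_vector_mult)
        then show ?thesis by (simp add: matrix_vector_mul_assoc R)
      qed
      define x where "x = (1 / (s - l)) *s v"
      have "s *s x - A' *v x = (1 / (s - l)) *s (s *s v - l *s v)"
        using v(2) by (simp add: x_def defs vector_scalar_commute vector_ssub_ldistrib
            vector_smult_assoc mult.commute)
      also have "s *s v - l *s v = (s - l) *s v"
        by (simp add: vector_sub_rdistrib)
      also have "(1 / (s - l)) *s ((s - l) *s v) = v"
        using elim(3) by (simp only: vector_smult_assoc) simp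
      finally have xv: "s *s x - A' *v x = v" .
      let ?g = "\<lambda>w. s *s w - (A' + B' ** K') *v w"
      have g: "?g = (*v) (mat s - (A' + B' ** K'))"
        by (auto simp: matrix_vector_mult_diff_rdistrib mat_vector_mult)
      have lin: "linear ?g" unfolding g by simp
      have "inj ?g"
      proof (subst linear_injective_0[OF lin], intro allI impI)
        fix z assume "?g z = 0"
        then have "d * norm z \<le> 0" using d(2)[OF elim(1), of z] by (metis norm_zero)
        then show "z = 0" using d(1) by (simp add: mult_le_0_iff)
      qed
      then have "surj ?g"
        using linear_injective_imp_surjective[OF lin] by simp
      then obtain w where "v = ?g w" by (rule surjE)
      then have w: "?g w = v" by (rule sym)
      have nw: "norm w \<le> w0"
        using d(2)[OF elim(1), of w] d(1) unfolding w by (simp add: w0_def field_simps)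
      have "s *s w - A' *v w = v + B' *v (K' *v w)"
        using w by (simp add: matrix_vector_mult_add_rdistrib matrix_vector_mul_assoc algebra_simps)
      then have "w = R *v v + R *v (B' *v (K' *v w))"
        using Rv[of w] by (simp add: matrix_vector_right_distrib)
      moreover have "R *v v = x" using Rv[of x] xv by simp
      ultimately have "x = w - R *v (B' *v (K' *v w))" by (simp add: algebra_simps)
      then have "C' *v x = C' *v (w - R *v (B' *v (K' *v w)))" by (rule arg_cong)
      also have "\<dots> = C' *v w - C' *v (R *v (B' *v (K' *v w)))"
        by (rule matrix_vector_mult_diff_distrib)
      also have "C' *v (R *v (B' *v (K' *v w))) = (C' ** R ** B') *v (K' *v w)"
        by (simp only: matrix_vector_mul_assoc matrix_mul_assoc)
      also have "C' ** R ** B' = transfer_function A B C D s - complexify D"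
        by (simp add: transfer_function_def defs R_def)
      finally have Cx: "C' *v x = C' *v w - (transfer_function A B C D s *v (K' *v w)
          - complexify D *v (K' *v w))"
        by (simp add: matrix_vector_mult_diff_rdistrib)
      have H: "norm (transfer_function A B C D s *v z) \<le> N * norm z" for z
        unfolding N_def by (rule matrix_vector_mult_bounded_by_entries)
          (use elim(4) abs_ge_self order_trans in blast)
      have Kw: "norm (K' *v w) \<le> cK * w0"
        using cK(1) nw by (intro order_trans[OF cK(2)] mult_left_mono) auto
      have "norm (C' *v x) \<le> norm (C' *v w) + (norm (transfer_function A B C D s *v (K' *v w))
          + norm (complexify D *v (K' *v w)))"
        unfolding Cx by (intro order_trans[OF norm_triangle_ineq4] add_left_mono norm_triangle_ineq4)
      also have "\<dots> \<le> cC * norm w + (N * norm (K' *v w) + cD * norm (K' *v w))"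
        by (intro add_mono cC cD H)
      also have "\<dots> = cC * norm w + (N + cD) * norm (K' *v w)"
        by (simp add: algebra_simps)
      also have "\<dots> \<le> cC * w0 + (N + cD) * (cK * w0)"
        using nw Kw cC cD N by (intro add_mono mult_left_mono) auto
      finally have nCx: "norm (C' *v x) \<le> cC * w0 + (N + cD) * (cK * w0)" .
      have "s *s x - (A' + L' ** C') *v x = v - L' *v (C' *v x)"
        using xv by (simp add: matrix_vector_mult_add_rdistrib matrix_vector_mul_assoc algebra_simps)
      then have "e * norm x \<le> norm (v - L' *v (C' *v x))"
        using e(2)[OF elim(2), of x] by simp
      also have "\<dots> \<le> norm v + norm (L' *v (C' *v x))" by (rule norm_triangle_ineq4)
      also have "\<dots> \<le> norm v + cL * norm (C' *v x)" using cL by simp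
      also have "\<dots> \<le> norm v + cL * (cC * w0 + (N + cD) * (cK * w0))"
        using nCx cL by (intro add_left_mono mult_left_mono) auto
      finally have "norm x \<le> bound"
        using e(1) by (simp add: bound_def field_simps)
      then show ?case
        by (simp add: x_def norm_vector_scalar_mult norm_divide)
    qed
  qed
  \<comment> \<open>Closer to \<open>l\<close> than this, \<open>norm v / cmod (s - l)\<close>
    exceeds \<open>bound\<close>; the form \<open>\<bar>bound\<bar> + 1\<close> keeps the
    denominator positive. As \<open>l\<close> is not isolated, the two estimates cannot both hold
    eventually.\<close>
  have "eventually (\<lambda>s. cmod (s - l) < norm v / (\<bar>bound\<bar> + 1)) (at l)"
    using v(1) by (auto simp: eventually_at dist_norm intro!: exI[of _ "norm v / (\<bar>bound\<bar> + 1)"])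
  moreover have "eventually (\<lambda>s. s \<noteq> l) (at l)"
    by (simp add: eventually_at_filter)
  ultimately have "eventually (\<lambda>s. False) (at l)"
    using ev
  proof eventually_elim
    case (elim s)
    have "norm v \<le> bound * cmod (s - l)"
      using elim(2,3) by (simp add: field_simps)
    also have "\<dots> \<le> (\<bar>bound\<bar> + 1) * cmod (s - l)" by (intro mult_right_mono) auto
    also have "\<dots> < norm v" using elim(1) by (simp add: field_simps)
    finally show False by simp
  qed
  then show False by simp
qed

section \<open>Lyapunov forms\<close>

lemma eigval_iff_det: "eigval M l \<longleftrightarrow> det (mat l - M) = 0"
proof -
  have "eigval M l \<longleftrightarrow> (\<exists>v. v \<noteq> 0 \<and> (mat l - M) *v v = 0)"
    by (auto simp: eigval_def matrix_vector_mult_diff_rdistrib mat_vector_mult)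
  also have "\<dots> \<longleftrightarrow> det (mat l - M) = 0"
    using invertible_det_nz[of "mat l - M"] invertible_left_inverse[of "mat l - M"]
      matrix_left_invertible_ker[of "mat l - M"] by blast
  finally show ?thesis .
qed

text \<open>Carries the Hurwitz condition over to the transpose, which acts on linear functionals of
  the state.\<close>

lemma eigval_transpose: "eigval (transpose M) l \<longleftrightarrow> eigval M l"
proof -
  have "mat l - transpose M = transpose (mat l - M)"
    by (auto simp: vec_eq_iff transpose_def mat_def)
  then show ?thesis by (simp only: eigval_iff_det det_transpose)
qed

text \<open>\<open>p(M) g\<close> by Horner's scheme.\<close>

definition poly_act :: "complex^'k^'k \<Rightarrow> complex^'k \<Rightarrow> complex poly \<Rightarrow> complex^'k" where
  "poly_act M g p = fold_coeffs (\<lambda>c v. c *s g + M *v v) p 0"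

lemma poly_act_0 [simp]: "poly_act M g 0 = 0"
  by (simp add: poly_act_def)

lemma poly_act_pCons [simp]: "poly_act M g (pCons c p) = c *s g + M *v poly_act M g p"
  by (cases "p = 0 \<and> c = 0") (auto simp: poly_act_def)

lemma poly_act_add: "poly_act M g (p + q) = poly_act M g p + poly_act M g q"
  by (induction p q rule: poly_induct2)
    (simp_all add: vector_sadd_rdistrib matrix_vector_right_distrib algebra_simps)

lemma poly_act_smult: "poly_act M g (smult z p) = z *s poly_act M g p"
  by (induction p) (simp_all add: vector_scalar_commute vector_smult_assoc vec.scale_right_distrib)

lemma poly_act_diff: "poly_act M g (p - q) = poly_act M g p - poly_act M g q"
  using poly_act_add[of M g "p - q" q] by simp

lemma poly_act_sum: "poly_act M g (\<Sum>i\<in>I. f i) = (\<Sum>i\<in>I. poly_act M g (f i))"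
  by (induction I rule: infinite_finite_induct) (simp_all add: poly_act_add)

lemma poly_act_linear_factor:
  "poly_act M g ([:- l, 1:] * q) = M *v poly_act M g q - l *s poly_act M g q"
  using poly_act_diff[of M g "pCons 0 q" "smult l q"]
  by (simp add: poly_act_smult)

text \<open>The vectors \<open>v i\<close>, which are the powers of \<open>M\<close> applied to
  \<open>g\<close>, number one more than the dimension, so a linear relation between them supplies
  \<open>p\<close>. Dependence speaks of a set of vectors, so a repetition among them is a separate
  case.\<close>

lemma ex_annihilating_poly:
  fixes M :: "complex^'k^'k"
  obtains p where "p \<noteq> 0" "poly_act M g p = 0"
proof -
  define v where "v i = poly_act M g (monom 1 i)" for i
  define N where "N = CARD('k)"
  show thesis
  proof (cases "inj_on v {..N}")
    case False
    then obtain i j where "i \<noteq> j" "v i = v j" by (auto simp: inj_on_def)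
    then show thesis
      by (intro that[of "monom 1 i - monom 1 j"]) (auto simp: v_def poly_act_diff monom_eq_iff')
  next
    case True
    then have "card (v ` {..N}) = N + 1" by (simp add: card_image)
    moreover have "vec.dim (v ` {..N}) \<le> N" unfolding N_def by (rule dim_subset_UNIV_cart_gen)
    ultimately have "vec.dependent (v ` {..N})"
      by (intro vec.dependent_biggerset_general) simp
    then obtain c where c: "\<exists>w\<in>v ` {..N}. c w \<noteq> 0" "(\<Sum>w\<in>v ` {..N}. c w *s w) = 0"
      by (auto simp: vec.dependent_finite)
    then obtain i where i: "i \<le> N" "c (v i) \<noteq> 0" by auto
    define p where "p = (\<Sum>i\<le>N. smult (c (v i)) (monom 1 i))"
    have "poly_act M g p = (\<Sum>i\<le>N. c (v i) *s v i)"
      by (simp add: p_def poly_act_sum poly_act_smult v_def)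
    also have "\<dots> = 0" using c(2) by (simp add: sum.reindex[OF True])
    finally have "poly_act M g p = 0" .
    moreover have "coeff p i = c (v i)"
      using i(1) by (simp add: p_def coeff_sum if_distrib cong: if_cong)
    then have "p \<noteq> 0" using i(2) by auto
    ultimately show thesis using that by blast
  qed
qed

text \<open>An eigenvector of the map induced by \<open>M\<close> on the quotient by
  \<open>W\<close>. Take a polynomial that sends \<open>g0\<close> into \<open>W\<close> and strip
  linear factors until the result first leaves \<open>W\<close>; that vector is \<open>g\<close>.
  Its \<open>l\<close> is an eigenvalue of \<open>M\<close> itself: otherwise \<open>l - M\<close>
  would be injective and, by dimension, map \<open>W\<close> onto \<open>W\<close>, so
  \<open>(l - M) g\<close> would have a preimage in \<open>W\<close>, which could only be
  \<open>g\<close>.\<close>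

lemma ex_quotient_eigenvector:
  fixes M :: "complex^'k^'k"
  assumes W: "vec.subspace W" "W \<noteq> UNIV" and inv: "\<And>f. f \<in> W \<Longrightarrow> M *v f \<in> W"
  obtains l g where "g \<notin> W" "M *v g - l *s g \<in> W" "eigval M l"
proof -
  obtain g0 where g0: "g0 \<notin> W" using W by auto
  have ex: "\<exists>l g. g \<notin> W \<and> M *v g - l *s g \<in> W"
    if "p \<noteq> 0" "poly_act M g0 p \<in> W" for p
    using that
  proof (induction "degree p" arbitrary: p)
    case 0
    then obtain c where c: "p = [:c:]" using degree_eq_zeroE by metis
    then have "c \<noteq> 0" "c *s g0 \<in> W" using 0 by auto
    then have "inverse c *s (c *s g0) \<in> W" using W vec.subspace_scale by blast
    then show ?case using g0 \<open>c \<noteq> 0\<close> by (simp add: vector_smult_assoc)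
  next
    case (Suc n)
    then have "\<not> constant (poly p)" by (simp add: constant_degree)
    then obtain l where "poly p l = 0" using fundamental_theorem_of_algebra by blast
    then obtain q where q: "p = [:- l, 1:] * q" by (metis dvdE poly_eq_0_iff_dvd)
    then have "q \<noteq> 0" "n = degree q" using Suc by (auto simp: degree_mult_eq simp del: mult_pCons_left)
    then show ?case
      using Suc q by (cases "poly_act M g0 q \<in> W") (auto simp: poly_act_linear_factor simp del: mult_pCons_left)
  qed
  obtain p where "p \<noteq> 0" "poly_act M g0 p = 0" by (rule ex_annihilating_poly)
  with ex[of p] obtain l g where g: "g \<notin> W" "M *v g - l *s g \<in> W"
    using vec.subspace_0[OF W(1)] by auto
  have "eigval M l"
  proof (rule ccontr)
    assume nE: "\<not> eigval M l"
    let ?N = "mat l - M"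
    have N: "?N *v v = l *s v - M *v v" for v
      by (simp add: matrix_vector_mult_diff_rdistrib mat_vector_mult)
    have inj: "v = w" if "?N *v v = ?N *v w" for v w
    proof -
      have "M *v (v - w) = l *s (v - w)"
        using that unfolding N by (simp add: matrix_vector_mult_diff_distrib vector_ssub_ldistrib algebra_simps)
      then have "v - w = 0" using nE unfolding eigval_def by blast
      then show ?thesis by simp
    qed
    have "(*v) ?N ` W \<subseteq> W"
      using inv W by (auto simp: N intro!: vec.subspace_diff vec.subspace_scale)
    moreover have "vec.dim ((*v) ?N ` W) = vec.dim W"
      by (rule vec.dim_image_eq) (auto intro!: inj_onI inj)
    ultimately have "(*v) ?N ` W = W"
      using W by (intro vec.subspace_dim_equal vec.subspace_image) auto
    moreover have "?N *v g \<in> W"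
      using vec.subspace_neg[OF W(1) g(2)] by (simp add: N)
    ultimately obtain w where "w \<in> W" "?N *v g = ?N *v w" by auto
    then show False using inj g(1) by blast
  qed
  then show thesis using that g by blast
qed

section \<open>Quadratic forms from complex functionals\<close>

text \<open>Bilinear, without conjugation, so that the action dual to \<open>A\<close> is the plain
  transpose.\<close>

definition pairing :: "complex^'k \<Rightarrow> real^'k \<Rightarrow> complex" where
  "pairing f x = (\<Sum>i\<in>UNIV. f $ i * of_real (x $ i))"

lemma pairing_add: "pairing (f + g) x = pairing f x + pairing g x"
  by (simp add: pairing_def algebra_simps sum.distrib)

lemma pairing_scale: "pairing (z *s f) x = z * pairing f x"
  by (simp add: pairing_def sum_distrib_left mult.assoc)

lemma pairing_transpose: "pairing (transpose (complexify A) *v f) x = pairing f (A *v x)"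
proof -
  have "pairing (transpose (complexify A) *v f) x =
      (\<Sum>i\<in>UNIV. \<Sum>j\<in>UNIV. f $ j * (of_real (A $ j $ i) * of_real (x $ i)))"
    by (simp add: pairing_def matrix_vector_mult_def transpose_def sum_distrib_left sum_distrib_right mult_ac)
  also have "\<dots> = pairing f (A *v x)"
    by (subst sum.swap) (simp add: pairing_def matrix_vector_mult_def sum_distrib_left)
  finally show ?thesis .
qed

lemma pairing_axis: "pairing (axis i 1) x = of_real (x $ i)"
  by (simp add: pairing_def axis_def if_distrib[where f="\<lambda>z. z * _"] cong: if_cong)

text \<open>The matrix of the squared modulus of \<open>pairing g x\<close>: the real part of a
  rank-one Hermitian matrix, whose antisymmetric imaginary part contributes nothing to the form on
  real vectors.\<close>

definition modulus_form :: "complex^'k \<Rightarrow> real^'k^'k" where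
  "modulus_form g = (\<chi> i j. Re (cnj (g $ i) * g $ j))"

lemma transpose_modulus_form: "transpose (modulus_form g) = modulus_form g"
  by (simp add: modulus_form_def transpose_def vec_eq_iff mult.commute)

lemma modulus_form_inner: "x \<bullet> (modulus_form g *v y) = Re (cnj (pairing g x) * pairing g y)"
proof -
  have "cnj (pairing g x) * pairing g y =
    (\<Sum>i\<in>UNIV. \<Sum>j\<in>UNIV. of_real (x $ i) * (cnj (g $ i) * g $ j * of_real (y $ j)))"
    unfolding pairing_def cnj_sum sum_product by (intro sum.cong refl) (simp add: mult_ac)
  also have "Re \<dots> = (\<Sum>i\<in>UNIV. \<Sum>j\<in>UNIV. x $ i * (Re (cnj (g $ i) * g $ j) * y $ j))"
    by (simp add: algebra_simps)
  finally show ?thesis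
    by (simp add: inner_vec_def modulus_form_def matrix_vector_mult_def sum_distrib_left)
qed

lemma modulus_form_square: "x \<bullet> (modulus_form g *v x) = (cmod (pairing g x))\<^sup>2"
  unfolding modulus_form_inner by (metis Re_complex_of_real complex_norm_square mult.commute)

text \<open>A Lyapunov form that need only control the functionals in \<open>W\<close>; the Lyapunov matrix of \<open>A\<close>
  is built up along a flag of invariant subspaces \<open>W\<close> of the dual space.\<close>

definition lyapunov_form :: "real^'m^'m \<Rightarrow> (complex^'m) set \<Rightarrow> real^'m^'m \<Rightarrow> bool" where
  "lyapunov_form A W Q \<longleftrightarrow> transpose Q = Q \<and> (\<forall>x. 0 \<le> x \<bullet> (Q *v x)) \<and>
     (\<exists>\<alpha>>0. \<forall>x. 2 * (x \<bullet> (Q *v (A *v x))) \<le> - \<alpha> * (x \<bullet> (Q *v x))) \<and>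
     (\<forall>f\<in>W. \<exists>K\<ge>0. \<forall>x. (cmod (pairing f x))\<^sup>2 \<le> K * (x \<bullet> (Q *v x)))"

text \<open>With \<open>h\<close> the remainder in \<open>W\<close>, the functional \<open>g\<close>
  satisfies \<open>g(A x) = l g(x) + h(x)\<close>. Hence the squared modulus of \<open>g(x)\<close>
  decays at rate \<open>- 2 * Re l\<close> up to a cross term with \<open>h\<close>. As
  \<open>Q\<close> controls \<open>h\<close>, a large multiple of \<open>Q\<close> absorbs this
  term.\<close>

lemma lyapunov_form_extend:
  fixes A :: "real^'m^'m"
  assumes Q: "lyapunov_form A W Q" and W: "vec.subspace W" and l: "Re l < 0"
    and h: "transpose (complexify A) *v g - l *s g \<in> W"
  obtains Q' where "lyapunov_form A (vec.span (insert g W)) Q'"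
proof -
  let ?q = "\<lambda>x. x \<bullet> (Q *v x)" and ?p = "\<lambda>x. (cmod (pairing g x))\<^sup>2"
  obtain \<alpha> where \<alpha>: "\<alpha> > 0" "\<And>x. 2 * (x \<bullet> (Q *v (A *v x))) \<le> - \<alpha> * ?q x"
    using Q by (auto simp: lyapunov_form_def)
  have q0: "0 \<le> ?q x" for x using Q by (auto simp: lyapunov_form_def)
  define h where "h = transpose (complexify A) *v g - l *s g"
  obtain K where K: "K \<ge> 0" "\<And>x. (cmod (pairing h x))\<^sup>2 \<le> K * ?q x"
    using Q assms(4) by (auto simp: lyapunov_form_def h_def)
  define \<mu> where "\<mu> = - Re l"
  have \<mu>: "\<mu> > 0" using l by (simp add: \<mu>_def)
  \<comment> \<open>Chosen so that \<open>m * \<alpha> / 2 = K / \<mu> + \<alpha> / 2\<close>: half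
    of the decay of \<open>m *\<^sub>R Q\<close> pays for the cross term. The summand 1 also makes
    \<open>m \<ge> 1\<close>, so that the new form dominates the old one.\<close>
  define m where "m = 2 * K / (\<mu> * \<alpha>) + 1"
  have m: "m \<ge> 1" using K \<mu> \<alpha> by (simp add: m_def)
  define Q' where "Q' = m *\<^sub>R Q + modulus_form g"
  have Q'_inner: "x \<bullet> (Q' *v y) = m * (x \<bullet> (Q *v y)) + x \<bullet> (modulus_form g *v y)" for x y
    by (simp add: Q'_def matrix_vector_mult_add_rdistrib scaleR_matrix_vector_assoc[symmetric]
        inner_add_right)
  have Q'_sq: "x \<bullet> (Q' *v x) = m * ?q x + ?p x" for x
    by (simp add: Q'_inner modulus_form_square)
  have deriv: "2 * (x \<bullet> (modulus_form g *v (A *v x))) \<le> - \<mu> * ?p x + K / \<mu> * ?q x" for x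
  proof -
    have "pairing g (A *v x) = l * pairing g x + pairing h x"
      unfolding pairing_transpose[symmetric] pairing_scale[symmetric] pairing_add[symmetric] h_def
      by simp
    then have "cnj (pairing g x) * pairing g (A *v x) =
        l * of_real (?p x) + cnj (pairing g x) * pairing h x"
      by (simp add: complex_norm_square algebra_simps del: of_real_power)
    then have "x \<bullet> (modulus_form g *v (A *v x)) = - \<mu> * ?p x + Re (cnj (pairing g x) * pairing h x)"
      by (simp add: modulus_form_inner \<mu>_def del: of_real_power)
    moreover have "Re (cnj (pairing g x) * pairing h x) \<le> cmod (pairing g x) * cmod (pairing h x)"
      by (metis complex_Re_le_cmod complex_mod_cnj norm_mult)
    \<comment> \<open>Young's inequality with weight \<open>\<mu>\<close>: it uses up half of the
      available rate \<open>2 * \<mu>\<close> and leaves \<open>\<mu>\<close>.\<close>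
    moreover have "2 * (cmod (pairing g x) * cmod (pairing h x))
        \<le> \<mu> * ?p x + (cmod (pairing h x))\<^sup>2 / \<mu>"
    proof -
      have "0 \<le> (\<mu> * cmod (pairing g x) - cmod (pairing h x))\<^sup>2 / \<mu>" using \<mu> by simp
      also have "\<dots> = \<mu> * ?p x + (cmod (pairing h x))\<^sup>2 / \<mu>
          - 2 * (cmod (pairing g x) * cmod (pairing h x))"
        using \<mu> by (simp add: field_simps power2_eq_square)
      finally show ?thesis by simp
    qed
    moreover have "(cmod (pairing h x))\<^sup>2 / \<mu> \<le> K / \<mu> * ?q x"
      using K(2)[of x] \<mu> by (simp add: divide_right_mono)
    ultimately show ?thesis by simp
  qed
  define \<beta> where "\<beta> = min (\<alpha> / 2) \<mu>"
  have \<beta>: "\<beta> > 0" "\<beta> \<le> \<alpha> / 2" "\<beta> \<le> \<mu>" using \<alpha> \<mu> by (auto simp: \<beta>_def)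
  have decay: "2 * (x \<bullet> (Q' *v (A *v x))) \<le> - \<beta> * (x \<bullet> (Q' *v x))" for x
  proof -
    have "2 * (x \<bullet> (Q' *v (A *v x))) = m * (2 * (x \<bullet> (Q *v (A *v x))))
        + 2 * (x \<bullet> (modulus_form g *v (A *v x)))"
      by (simp add: Q'_inner algebra_simps)
    also have "\<dots> \<le> m * (- \<alpha> * ?q x) + (- \<mu> * ?p x + K / \<mu> * ?q x)"
      using m by (intro add_mono mult_left_mono \<alpha> deriv) auto
    also have "K / \<mu> \<le> m * \<alpha> / 2"
    proof -
      have "m * \<alpha> / 2 = K / \<mu> + \<alpha> / 2"
        using \<alpha>(1) \<mu> by (simp add: m_def field_simps)
      then show ?thesis using \<alpha>(1) by simp
    qed
    then have "m * (- \<alpha> * ?q x) + (- \<mu> * ?p x + K / \<mu> * ?q x)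
        \<le> m * (- \<alpha> * ?q x) + (- \<mu> * ?p x + m * \<alpha> / 2 * ?q x)"
      using q0 by (intro add_left_mono mult_right_mono) auto
    also have "\<dots> = - (\<alpha> / 2) * (m * ?q x) - \<mu> * ?p x"
      by (simp add: field_simps)
    also have "\<dots> \<le> - \<beta> * (m * ?q x) - \<beta> * ?p x"
      using \<beta> m q0[of x] by (intro diff_mono mult_right_mono) auto
    finally show ?thesis by (simp add: Q'_sq algebra_simps)
  qed
  have "transpose Q' = Q'"
  proof -
    have "transpose Q = Q" using Q by (simp add: lyapunov_form_def)
    then show ?thesis
      using transpose_modulus_form[of g] by (simp add: Q'_def transpose_def vec_eq_iff)
  qed
  moreover have "0 \<le> x \<bullet> (Q' *v x)" for x
    unfolding Q'_sq using q0 m by simp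
  moreover have "\<exists>K\<ge>0. \<forall>x. (cmod (pairing f x))\<^sup>2 \<le> K * (x \<bullet> (Q' *v x))"
    if f: "f \<in> vec.span (insert g W)" for f
  proof -
    obtain k where k: "f - k *s g \<in> W"
      using f W by (auto simp: vec.span_insert vec.span_eq_iff[THEN iffD2])
    obtain K where K: "K \<ge> 0" "\<And>x. (cmod (pairing (f - k *s g) x))\<^sup>2 \<le> K * ?q x"
      using Q k by (auto simp: lyapunov_form_def)
    have "(cmod (pairing f x))\<^sup>2 \<le> (2 * K + 2 * (cmod k)\<^sup>2) * (x \<bullet> (Q' *v x))" for x
    proof -
      have "pairing f x = pairing (f - k *s g) x + k * pairing g x"
        by (simp add: pairing_scale[symmetric] pairing_add[symmetric])
      then have "cmod (pairing f x) \<le> cmod (pairing (f - k *s g) x) + cmod k * cmod (pairing g x)"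
        by (metis norm_mult norm_triangle_ineq)
      then have "(cmod (pairing f x))\<^sup>2
          \<le> (cmod (pairing (f - k *s g) x) + cmod k * cmod (pairing g x))\<^sup>2"
        by (intro power_mono) auto
      also have "\<dots> \<le> 2 * (cmod (pairing (f - k *s g) x))\<^sup>2 + 2 * (cmod k * cmod (pairing g x))\<^sup>2"
        using sum_squares_bound[of "cmod (pairing (f - k *s g) x)" "cmod k * cmod (pairing g x)"]
        by (simp add: power2_sum)
      also have "\<dots> \<le> 2 * (K * ?q x) + 2 * ((cmod k)\<^sup>2 * ?p x)"
        using K(2)[of x] by (simp add: power_mult_distrib)
      also have "\<dots> \<le> 2 * K * (m * ?q x + ?p x) + 2 * (cmod k)\<^sup>2 * (m * ?q x + ?p x)"
      proof -
        have "1 * ?q x \<le> m * ?q x" using m q0 by (intro mult_right_mono) auto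
        then have "?q x \<le> m * ?q x + ?p x" by (simp add: add_increasing2)
        then have "K * ?q x \<le> K * (m * ?q x + ?p x)" using K(1) by (rule mult_left_mono)
        moreover have "(cmod k)\<^sup>2 * ?p x \<le> (cmod k)\<^sup>2 * (m * ?q x + ?p x)"
          using m q0[of x] by (intro mult_left_mono) auto
        ultimately show ?thesis by simp
      qed
      finally show ?thesis by (simp add: Q'_sq algebra_simps)
    qed
    then show ?thesis using K(1) by (intro exI[of _ "2 * K + 2 * (cmod k)\<^sup>2"]) auto
  qed
  ultimately have "lyapunov_form A (vec.span (insert g W)) Q'"
    using decay \<beta>(1) unfolding lyapunov_form_def by blast
  then show thesis by (rule that)
qed

text \<open>Induction on the dimension of an invariant \<open>W\<close>, from \<open>{0}\<close>
  with the zero form. Each step adjoins an eigenvector modulo \<open>W\<close>; its eigenvalue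
  belongs to \<open>A\<close>, hence has negative real part.\<close>

lemma ex_lyapunov_form:
  fixes A :: "real^'m^'m"
  assumes "hurwitz A"
  obtains Q where "lyapunov_form A UNIV Q"
proof -
  let ?M = "transpose (complexify A)"
  have "\<exists>W Q. vec.subspace W \<and> (\<forall>f\<in>W. ?M *v f \<in> W) \<and> vec.dim W = n \<and> lyapunov_form A W Q"
    if "n \<le> CARD('m)" for n
    using that
  proof (induction n)
    case 0
    have "lyapunov_form A {0} 0"
      by (auto simp: lyapunov_form_def pairing_def transpose_def vec_eq_iff intro!: exI[of _ 1])
    moreover have "vec.subspace {0::complex^'m}" by simp
    moreover have "vec.dim {0::complex^'m} = 0" by simp
    moreover have "\<forall>f\<in>{0}. ?M *v f \<in> {0}" by simp
    ultimately show ?case by blast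
  next
    case (Suc n)
    then obtain W Q where W: "vec.subspace W" "\<And>f. f \<in> W \<Longrightarrow> ?M *v f \<in> W" "vec.dim W = n"
      and Q: "lyapunov_form A W Q" by auto
    have "W \<noteq> UNIV" using W(3) Suc.prems by (metis Suc_n_not_le_n vec_dim_card)
    then obtain l g where g: "g \<notin> W" "?M *v g - l *s g \<in> W" "eigval ?M l"
      using ex_quotient_eigenvector[OF W(1) _ W(2)] by blast
    have "Re l < 0"
      using assms g(3) by (simp add: hurwitz_def eigval_transpose)
    then obtain Q' where Q': "lyapunov_form A (vec.span (insert g W)) Q'"
      using lyapunov_form_extend[OF Q W(1) _ g(2)] by blast
    have span: "vec.span W = W" using W(1) by (simp add: vec.span_eq_iff)
    have "?M *v f \<in> vec.span (insert g W)" if f: "f \<in> vec.span (insert g W)" for f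
    proof -
      obtain k where k: "f - k *s g \<in> W"
        using f by (auto simp: vec.span_insert span)
      have "?M *v f = ?M *v (f - k *s g) + k *s (?M *v g - l *s g) + (k * l) *s g"
        by (simp add: matrix_vector_mult_diff_distrib vector_scalar_commute vector_ssub_ldistrib
            vector_smult_assoc)
      then have "?M *v f - (k * l) *s g = ?M *v (f - k *s g) + k *s (?M *v g - l *s g)"
        by simp
      also have "\<dots> \<in> W"
        using W(1) W(2)[OF k] g(2) by (intro vec.subspace_add vec.subspace_scale)
      finally show ?thesis by (auto simp: vec.span_insert span)
    qed
    moreover have "vec.dim (vec.span (insert g W)) = Suc n"
      using g(1) W(3) by (simp add: vec.dim_insert span)
    ultimately show ?case using Q' by (meson vec.subspace_span)
  qed
  from this[of "CARD('m)"] obtain W Q where "vec.subspace W" "vec.dim W = CARD('m)"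
    "lyapunov_form A W Q" by auto
  moreover from this have "W = UNIV"
    by (metis vec.subspace_UNIV vec.subspace_dim_equal subset_UNIV order_refl vec_dim_card)
  ultimately show thesis using that by blast
qed

text \<open>Control of all functionals includes the coordinates, which makes \<open>Q\<close>
  definite and therefore its decay strict.\<close>

lemma hurwitz_lyapunov:
  fixes A :: "real^'m^'m"
  assumes "hurwitz A"
  obtains Q where "transpose Q = Q" "\<And>x. x \<noteq> 0 \<Longrightarrow> 0 < x \<bullet> (Q *v x)"
    "\<And>x. x \<noteq> 0 \<Longrightarrow> x \<bullet> (Q *v (A *v x)) < 0"
proof -
  obtain Q where Q: "lyapunov_form A UNIV Q" using ex_lyapunov_form[OF assms] .
  have pos: "0 < x \<bullet> (Q *v x)" if x: "x \<noteq> 0" for x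
  proof -
    obtain i where i: "x $ i \<noteq> 0" using x by (auto simp: vec_eq_iff)
    obtain K where K: "\<And>x. (cmod (pairing (axis i 1) x))\<^sup>2 \<le> K * (x \<bullet> (Q *v x))"
      using Q unfolding lyapunov_form_def by blast
    have "0 < (cmod (pairing (axis i 1) x))\<^sup>2" using i by (simp add: pairing_axis)
    then have "x \<bullet> (Q *v x) \<noteq> 0" using K[of x] by auto
    moreover have "0 \<le> x \<bullet> (Q *v x)" using Q by (auto simp: lyapunov_form_def)
    ultimately show ?thesis by simp
  qed
  moreover have "x \<bullet> (Q *v (A *v x)) < 0" if x: "x \<noteq> 0" for x
  proof -
    obtain \<alpha> where "\<alpha> > 0" "2 * (x \<bullet> (Q *v (A *v x))) \<le> - \<alpha> * (x \<bullet> (Q *v x))"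
      using Q by (auto simp: lyapunov_form_def)
    moreover from this pos[OF x] have "- \<alpha> * (x \<bullet> (Q *v x)) < 0" by simp
    ultimately show ?thesis by linarith
  qed
  ultimately show thesis using Q that by (auto simp: lyapunov_form_def)
qed

section \<open>Positive semidefiniteness from decay along the flow\<close>

lemma symmetric_inner:
  fixes P :: "real^'m^'m"
  assumes "transpose P = P"
  shows "x \<bullet> (P *v y) = y \<bullet> (P *v x)"
  by (metis assms dot_lmul_matrix inner_commute transpose_matrix_vector)

text \<open>With \<open>t\<close> the largest value of \<open>- (v \<bullet> P v) / (v \<bullet> Q v)\<close>, attained at \<open>w\<close>, the matrix
  \<open>P + t Q\<close> is positive semidefinite and kills \<open>w\<close>. If \<open>t > 0\<close>, the derivative of its form
  along the flow is both zero and negative at \<open>w\<close>.\<close>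

lemma hurwitz_lyapunov_nonneg:
  fixes A P :: "real^'m^'m"
  assumes A: "hurwitz A" and P: "transpose P = P"
    and decay: "\<And>x. x \<bullet> (P *v (A *v x)) \<le> 0"
  shows "0 \<le> x \<bullet> (P *v x)"
proof -
  obtain Q where Q: "transpose Q = Q" "\<And>x. x \<noteq> 0 \<Longrightarrow> 0 < x \<bullet> (Q *v x)"
    "\<And>x. x \<noteq> 0 \<Longrightarrow> x \<bullet> (Q *v (A *v x)) < 0"
    using hurwitz_lyapunov[OF A] by blast
  define r where "r v = - (v \<bullet> (P *v v)) / (v \<bullet> (Q *v v))" for v
  have cont: "continuous_on S (\<lambda>v. v \<bullet> (M *v v))" for M :: "real^'m^'m" and S
    by (intro continuous_on_inner continuous_on_id linear_continuous_on matrix_vector_mul_bounded_linear)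
  have "v \<bullet> (Q *v v) \<noteq> 0" if "v \<in> sphere 0 1" for v
  proof -
    have "v \<noteq> 0" using that by auto
    then show ?thesis using Q(2)[of v] by simp
  qed
  then have "continuous_on (sphere 0 1) r"
    unfolding r_def by (intro continuous_on_divide continuous_on_minus cont) blast
  moreover have "sphere 0 1 \<noteq> ({}::(real^'m) set)" by simp
  ultimately obtain w where w: "norm w = 1" "\<And>v. norm v = 1 \<Longrightarrow> r v \<le> r w"
    using continuous_attains_sup[OF compact_sphere, of 0 1 r] by auto
  then have w0: "w \<noteq> 0" by auto
  define R where "R = P + r w *\<^sub>R Q"
  have R: "x \<bullet> (R *v y) = x \<bullet> (P *v y) + r w * (x \<bullet> (Q *v y))" for x y
    by (simp add: R_def matrix_vector_mult_add_rdistrib scaleR_matrix_vector_assoc[symmetric]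
        inner_add_right)
  have Rt: "transpose R = R"
    using P Q(1) by (simp add: R_def transpose_def vec_eq_iff)
  have Rpos: "0 \<le> v \<bullet> (R *v v)" for v
  proof (cases "v = 0")
    case False
    define z where "z = v /\<^sub>R norm v"
    have z: "norm z = 1" "z \<noteq> 0" using False by (auto simp: z_def)
    have "0 \<le> z \<bullet> (R *v z)"
      using w(2)[OF z(1)] Q(2)[OF z(2)] unfolding R by (simp add: r_def field_simps)
    moreover have "v \<bullet> (R *v v) = (norm v)\<^sup>2 * (z \<bullet> (R *v z))"
      using False by (simp add: z_def matrix_vector_mult_scaleR power2_eq_square field_simps)
    ultimately show ?thesis by simp
  qed simp
  have "w \<bullet> (R *v w) = 0"
    using Q(2)[OF w0] by (simp add: R r_def)
  \<comment> \<open>A semidefinite form vanishes only on the kernel of its matrix: otherwise a small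
    move from \<open>w\<close> against \<open>R *v w\<close> would make the form negative.\<close>
  have Rw: "R *v w = 0"
  proof (rule ccontr)
    define y where "y = R *v w"
    assume "R *v w \<noteq> 0"
    then have y: "y \<bullet> y > 0" by (simp add: y_def)
    define c where "c = y \<bullet> (R *v y)"
    have "0 \<le> (w - s *\<^sub>R y) \<bullet> (R *v (w - s *\<^sub>R y))" for s by (rule Rpos)
    moreover have "(w - s *\<^sub>R y) \<bullet> (R *v (w - s *\<^sub>R y)) = s * (s * c - 2 * (y \<bullet> y))" for s
      using \<open>w \<bullet> (R *v w) = 0\<close> symmetric_inner[OF Rt, of w y]
      by (simp add: matrix_vector_mult_diff_distrib matrix_vector_mult_scaleR inner_diff_left
          inner_diff_right c_def y_def[symmetric] algebra_simps)
    ultimately have le: "0 \<le> s * (s * c - 2 * (y \<bullet> y))" for s by metis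
    have "c \<ge> 0" using Rpos by (simp add: c_def)
    \<comment> \<open>Small enough that \<open>s * c\<close> stays below
      \<open>2 * (y \<bullet> y)\<close>; the summand 1 covers \<open>c = 0\<close>.\<close>
    define s where "s = (y \<bullet> y) / (c + 1)"
    have "s > 0" using y \<open>c \<ge> 0\<close> by (simp add: s_def)
    then have "0 \<le> s * c - 2 * (y \<bullet> y)" using le[of s] by (simp add: zero_le_mult_iff)
    moreover have "s * c \<le> y \<bullet> y"
      using y \<open>c \<ge> 0\<close> by (simp add: s_def field_simps)
    ultimately show False using y by simp
  qed
  have "r w \<le> 0"
  proof (rule ccontr)
    assume "\<not> r w \<le> 0"
    then have "r w * (w \<bullet> (Q *v (A *v w))) < 0"
      using Q(3)[OF w0] by (simp add: mult_less_0_iff)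
    then have "w \<bullet> (R *v (A *v w)) < 0" using decay[of w] by (simp add: R)
    moreover have "w \<bullet> (R *v (A *v w)) = 0"
      using symmetric_inner[OF Rt, of w "A *v w"] Rw by simp
    ultimately show False by simp
  qed
  moreover have "0 \<le> x \<bullet> (Q *v x)" using Q(2)[of x] by (cases "x = 0") auto
  ultimately have "r w * (x \<bullet> (Q *v x)) \<le> 0" by (simp add: mult_le_0_iff)
  then show ?thesis using Rpos[of x] by (simp add: R)
qed

section \<open>Dissipation along trajectories\<close>

definition stack :: "real^'m \<Rightarrow> real^'n \<Rightarrow> real^('m + 'n)" where
  "stack x u = (\<chi> i. case i of Inl i \<Rightarrow> x $ i | Inr i \<Rightarrow> u $ i)"

lemma sum_UNIV_Plus:
  fixes f :: "'a::finite + 'b::finite \<Rightarrow> 'c::comm_monoid_add"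
  shows "sum f UNIV = (\<Sum>i\<in>UNIV. f (Inl i)) + (\<Sum>i\<in>UNIV. f (Inr i))"
  unfolding UNIV_Plus_UNIV[symmetric] by (subst sum.Plus) (simp_all add: o_def)

lemma block_mult_stack: "block M N K L *v stack x u = stack (M *v x + N *v u) (K *v x + L *v u)"
  by (simp add: vec_eq_iff block_def stack_def matrix_vector_mult_def sum_UNIV_Plus split: sum.split)

lemma stack_inner: "stack x u \<bullet> stack y v = x \<bullet> y + u \<bullet> v"
  by (simp add: inner_vec_def stack_def sum_UNIV_Plus)

lemma inner_congruence:
  fixes X :: "real^'k^'l"
  shows "v \<bullet> ((transpose X ** Y ** X) *v v) = (X *v v) \<bullet> (Y *v (X *v v))"
proof -
  have "(transpose X ** Y ** X) *v v = transpose X *v (Y *v (X *v v))"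
    by (simp only: matrix_vector_mul_assoc matrix_mul_assoc)
  then show ?thesis
    by (metis dot_lmul_matrix transpose_matrix_vector inner_commute)
qed

lemma multiplier_simps:
  "multiplier a b c $ 1 $ 1 = a" "multiplier a b c $ 1 $ 2 = b"
  "multiplier a b c $ 2 $ 1 = b" "multiplier a b c $ 2 $ 2 = c"
  by (simp_all add: multiplier_def)

text \<open>The matrix inequality tested on the vector \<open>stack x u\<close>. Since
  \<open>A *v x + B *v u\<close> is the velocity of the state, the left side is the rate of change
  of \<open>x \<bullet> (P *v x)\<close> and the right side is the supply rate.\<close>

lemma lmi_dissipation:
  fixes A :: "real^'m^'m" and B :: "real^'n^'m" and C :: "real^'m^'n" and D :: "real^'n^'n"
  assumes "neg_semidef
             (transpose (block A B (mat 1) 0) ** block 0 P P 0 ** block A B (mat 1) 0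
              - varrho C D (multiplier a b c))"
    and P: "transpose P = P"
  shows "2 * ((A *v x + B *v u) \<bullet> (P *v x))
    \<le> a * ((C *v x + D *v u) \<bullet> (C *v x + D *v u)) + 2 * b * (u \<bullet> (C *v x + D *v u)) + c * (u \<bullet> u)"
proof -
  let ?v = "stack x u" and ?y = "C *v x + D *v u" and ?w = "A *v x + B *v u"
  have "?v \<bullet> ((transpose (block A B (mat 1) 0) ** block 0 P P 0 ** block A B (mat 1) 0) *v ?v)
      = ?w \<bullet> (P *v x) + x \<bullet> (P *v ?w)"
    unfolding inner_congruence block_mult_stack by (simp add: stack_inner)
  moreover have "x \<bullet> (P *v ?w) = ?w \<bullet> (P *v x)" using symmetric_inner[OF P] .
  moreover have "?v \<bullet> (varrho C D (multiplier a b c) *v ?v)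
      = a * (?y \<bullet> ?y) + 2 * b * (u \<bullet> ?y) + c * (u \<bullet> u)"
  proof -
    have "mat k *v z = k *\<^sub>R z" for k and z :: "real^'n"
      by (simp add: mat_vector_mult scalar_mult_eq_scaleR)
    moreover have "block C D 0 (mat 1) *v ?v = stack ?y u"
      unfolding block_mult_stack by simp
    ultimately have "?v \<bullet> (varrho C D (multiplier a b c) *v ?v)
        = stack ?y u \<bullet> stack (a *\<^sub>R ?y + b *\<^sub>R u) (b *\<^sub>R ?y + c *\<^sub>R u)"
      unfolding varrho_def inner_congruence kronecker_id_block multiplier_simps
      by (simp only: block_mult_stack)
    then show ?thesis
      unfolding stack_inner inner_add_right[of _ "_ *\<^sub>R _" "_ *\<^sub>R _"] inner_scaleR_right
        inner_commute[of ?y u] by simp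
  qed
  moreover have "?v \<bullet> ((transpose (block A B (mat 1) 0) ** block 0 P P 0 ** block A B (mat 1) 0
              - varrho C D (multiplier a b c)) *v ?v) \<le> 0"
    using assms(1) by (simp add: neg_semidef_def)
  ultimately show ?thesis
    by (simp add: matrix_vector_mult_diff_rdistrib inner_diff_right)
qed

section \<open>The product rule along trajectories\<close>

text \<open>Local bounds by increments of \<open>F\<close> telescope over steps of length at most
  \<open>\<delta> / 2\<close>, so the constant \<open>c\<close> does not grow with the number of
  steps.\<close>

lemma increment_bound_from_local:
  fixes G F :: "real \<Rightarrow> real"
  assumes "\<delta> > 0" "c \<ge> 0"
    and "\<And>s t. \<lbrakk>0 \<le> s; s \<le> t; t \<le> T; t - s < \<delta>\<rbrakk> \<Longrightarrow> \<bar>G t - G s\<bar> \<le> c * (F t - F s)"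
    and "0 \<le> t" "t \<le> T"
  shows "\<bar>G t - G 0\<bar> \<le> c * (F t - F 0)"
proof -
  have "\<bar>G t - G 0\<bar> \<le> c * (F t - F 0)" if "0 \<le> t" "t \<le> T" "t \<le> real k * (\<delta> / 2)" for k t
    using that
  proof (induction k arbitrary: t)
    case 0
    then have "t = 0" by simp
    then show ?case by simp
  next
    case (Suc k)
    define s where "s = max 0 (t - \<delta> / 2)"
    have s: "0 \<le> s" "s \<le> t" "s \<le> T" "t - s < \<delta>" "s \<le> real k * (\<delta> / 2)"
      using Suc.prems assms(1) by (cases "t \<le> \<delta> / 2"; simp add: s_def algebra_simps)+
    have "\<bar>G s - G 0\<bar> \<le> c * (F s - F 0)" using Suc.IH s by blast
    moreover have "\<bar>G t - G s\<bar> \<le> c * (F t - F s)" using assms(3) s Suc.prems by blast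
    ultimately show ?case by (simp add: right_diff_distrib)
  qed
  moreover obtain k :: nat where "t / (\<delta> / 2) \<le> real k" using real_arch_simple by blast
  then have "t \<le> real k * (\<delta> / 2)" using assms(1) by (simp add: field_simps)
  ultimately show ?thesis using assms by blast
qed

text \<open>The product rule for an absolutely continuous function, which need not be differentiable
  anywhere in the classical sense. On short intervals the error is bounded by the oscillation
  of \<open>x\<close> times the integral of \<open>norm w\<close>.\<close>

lemma has_integral_quadratic_form:
  fixes x w :: "real \<Rightarrow> real^'m" and P :: "real^'m^'m"
  assumes w: "w absolutely_integrable_on {0..T}" and T: "0 \<le> T"
    and x: "\<And>t. \<lbrakk>0 \<le> t; t \<le> T\<rbrakk> \<Longrightarrow> (w has_integral x t) {0..t}"
    and P: "transpose P = P"
  shows "((\<lambda>t. 2 * (w t \<bullet> (P *v x t))) has_integral x T \<bullet> (P *v x T)) {0..T}"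
proof -
  have wi: "w integrable_on {0..T}" and ni: "(\<lambda>t. norm (w t)) integrable_on {0..T}"
    using w by (auto simp: absolutely_integrable_on_def)
  have xi: "x t = integral {0..t} w" if "0 \<le> t" "t \<le> T" for t
    using x[OF that] by (simp add: integral_unique)
  have cont: "continuous_on {0..T} x"
    using indefinite_integral_continuous_1[OF wi] by (rule continuous_on_eq) (simp add: xi)
  have "bilinear (\<lambda>v z. 2 * (z \<bullet> (P *v v)))"
    unfolding bilinear_def
    by (auto intro!: linearI simp: matrix_vector_right_distrib matrix_vector_mult_scaleR
        inner_add_left inner_add_right algebra_simps)
  then have "(\<lambda>t. 2 * (w t \<bullet> (P *v x t))) absolutely_integrable_on {0..T}"
    using w cont
    by (intro absolutely_integrable_bounded_measurable_product[where h="\<lambda>v z. 2 * (z \<bullet> (P *v v))"]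
        continuous_imp_measurable_on_sets_lebesgue compact_imp_bounded compact_continuous_image) auto
  then have ji: "(\<lambda>t. 2 * (w t \<bullet> (P *v x t))) integrable_on {0..T}" (is "?j integrable_on _")
    by (simp add: absolutely_integrable_on_def)
  define F where "F t = integral {0..t} (\<lambda>t. norm (w t))" for t
  define J where "J t = integral {0..t} ?j" for t
  define G where "G t = x t \<bullet> (P *v x t) - J t" for t
  obtain K where K: "K > 0" "\<And>v. norm (P *v v) \<le> K * norm v"
  proof -
    obtain K where "K > 0" "\<forall>v. norm (P *v v) \<le> norm v * K"
      using bounded_linear.pos_bounded[OF matrix_vector_mul_bounded_linear[of P]] by blast
    then show thesis by (intro that[of K]) (auto simp: mult.commute)
  qed
  have diff: "integral {s..t} f = integral {0..t} f - integral {0..s} f" "f integrable_on {s..t}"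
    if "f integrable_on {0..T}" "0 \<le> s" "s \<le> t" "t \<le> T" for s t and f :: "real \<Rightarrow> 'b::banach"
  proof -
    have "f integrable_on {0..t}" using that by (intro integrable_on_subinterval[OF that(1)]) auto
    then show "integral {s..t} f = integral {0..t} f - integral {0..s} f"
      using Henstock_Kurzweil_Integration.integral_combine[of 0 s t f] that by (simp add: algebra_simps)
    show "f integrable_on {s..t}" using that by (intro integrable_on_subinterval[OF that(1)]) auto
  qed
  \<comment> \<open>The increment of the form over \<open>{s..t}\<close> is the integral of
    \<open>w r \<bullet> (P *v (x t + x s))\<close>. Comparing with
    \<open>2 * (w r \<bullet> (P *v x r))\<close> leaves the second difference
    \<open>(x t - x r) - (x r - x s)\<close>, of norm at most \<open>2 * e\<close>.\<close>
  have local_bound: "\<bar>G t - G s\<bar> \<le> (2 * K * e) * (F t - F s)"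
    if st: "0 \<le> s" "s \<le> t" "t \<le> T" and e: "\<And>r. r \<in> {s..t} \<Longrightarrow> norm (x r - x s) \<le> e \<and> norm (x t - x r) \<le> e"
    for s t e
  proof -
    let ?c = "P *v (x t + x s)"
    have wst: "w integrable_on {s..t}" "integral {s..t} w = x t - x s"
      using diff[OF wi st] st by (auto simp: xi)
    have c: "((\<lambda>r. w r \<bullet> ?c) has_integral (x t - x s) \<bullet> ?c) {s..t}"
      using has_integral_linear[OF integrable_integral[OF wst(1)] bounded_linear_inner_left[of ?c]]
      by (simp add: wst(2) o_def)
    have "x t \<bullet> (P *v x t) - x s \<bullet> (P *v x s) = (x t - x s) \<bullet> ?c"
      using symmetric_inner[OF P, of "x t" "x s"]
      by (simp add: matrix_vector_right_distrib inner_diff_left inner_add_right)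
    also have "\<dots> = integral {s..t} (\<lambda>r. w r \<bullet> ?c)" using c by (simp add: integral_unique)
    finally have "G t - G s = integral {s..t} (\<lambda>r. w r \<bullet> ?c) - integral {s..t} ?j"
      using diff(1)[OF ji st] by (simp add: G_def J_def)
    also have "\<dots> = integral {s..t} (\<lambda>r. w r \<bullet> ?c - ?j r)"
      using c diff(2)[OF ji st] by (intro integral_diff[symmetric]) auto
    finally have Gd: "G t - G s = integral {s..t} (\<lambda>r. w r \<bullet> ?c - ?j r)" .
    have "norm (integral {s..t} (\<lambda>r. w r \<bullet> ?c - ?j r)) \<le> integral {s..t} (\<lambda>r. 2 * K * e * norm (w r))"
    proof (rule Henstock_Kurzweil_Integration.integral_norm_bound_integral)
      show "(\<lambda>r. w r \<bullet> ?c - ?j r) integrable_on {s..t}"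
        using c diff(2)[OF ji st] by (intro integrable_diff) auto
      show "(\<lambda>r. 2 * K * e * norm (w r)) integrable_on {s..t}"
        using integrable_cmul[OF diff(2)[OF ni st], of "2 * K * e"] by simp
      fix r assume r: "r \<in> {s..t}"
      have "w r \<bullet> ?c - ?j r = w r \<bullet> (P *v ((x t - x r) - (x r - x s)))"
      proof -
        have "(x t - x r) - (x r - x s) = (x t + x s) - 2 *\<^sub>R x r"
          by (simp add: scaleR_2 algebra_simps)
        then show ?thesis
          by (simp only: matrix_vector_mult_diff_distrib matrix_vector_mult_scaleR
              inner_diff_right inner_scaleR_right)
      qed
      then have "norm (w r \<bullet> ?c - ?j r) \<le> norm (w r) * norm (P *v ((x t - x r) - (x r - x s)))"
        using Cauchy_Schwarz_ineq2 by simp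
      also have "\<dots> \<le> norm (w r) * (K * norm ((x t - x r) - (x r - x s)))"
        by (intro mult_left_mono K) auto
      also have "\<dots> \<le> norm (w r) * (K * (2 * e))"
      proof -
        have "norm ((x t - x r) - (x r - x s)) \<le> 2 * e"
          using norm_triangle_ineq4[of "x t - x r" "x r - x s"] e[OF r] by linarith
        then show ?thesis using K(1) by (intro mult_left_mono) auto
      qed
      finally show "norm (w r \<bullet> ?c - ?j r) \<le> 2 * K * e * norm (w r)" by (simp add: mult_ac)
    qed
    also have "\<dots> = 2 * K * e * (F t - F s)"
      using diff(1)[OF ni st] by (simp add: F_def)
    finally show ?thesis by (simp add: Gd)
  qed
  have FT: "F T - F 0 \<ge> 0"
    unfolding F_def by (simp add: integral_nonneg[OF ni])
  have "\<bar>G T - G 0\<bar> \<le> \<eta>" if \<eta>: "\<eta> > 0" for \<eta>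
  proof -
    \<comment> \<open>Makes the accumulated error at most \<open>\<eta>\<close>; the summand 1 keeps
      the denominator positive when \<open>F T = F 0\<close>.\<close>
    define e where "e = \<eta> / (2 * K * (F T - F 0) + 1)"
    have den: "2 * K * (F T - F 0) + 1 > 0" using K FT by (simp add: add_nonneg_pos)
    then have e: "e > 0" using \<eta> by (simp add: e_def)
    have "uniformly_continuous_on {0..T} x"
      using cont by (simp add: compact_uniformly_continuous)
    then obtain \<delta> where \<delta>: "\<delta> > 0"
      "\<And>s t. \<lbrakk>s \<in> {0..T}; t \<in> {0..T}; dist t s < \<delta>\<rbrakk> \<Longrightarrow> dist (x t) (x s) < e"
      using e unfolding uniformly_continuous_on_def by metis
    have "\<bar>G T - G 0\<bar> \<le> (2 * K * e) * (F T - F 0)"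
    proof (rule increment_bound_from_local[OF \<delta>(1) _ _ T order_refl])
      show "0 \<le> 2 * K * e" using K e by simp
      fix s t assume st: "0 \<le> s" "s \<le> t" "t \<le> T" "t - s < \<delta>"
      show "\<bar>G t - G s\<bar> \<le> (2 * K * e) * (F t - F s)"
      proof (rule local_bound[OF st(1-3)])
        fix r assume "r \<in> {s..t}"
        then show "norm (x r - x s) \<le> e \<and> norm (x t - x r) \<le> e"
          using \<delta>(2)[of s r] \<delta>(2)[of r t] st by (auto simp: dist_norm less_imp_le)
      qed
    qed
    also have "\<dots> = \<eta> * (2 * K * (F T - F 0)) / (2 * K * (F T - F 0) + 1)"
      by (simp add: e_def)
    also have "\<dots> \<le> \<eta>"
      using den \<eta> by (simp add: pos_divide_le_eq algebra_simps)
    finally show ?thesis .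
  qed
  then have "\<bar>G T - G 0\<bar> \<le> 0" using field_le_epsilon[of "\<bar>G T - G 0\<bar>" 0] by simp
  moreover have "G 0 = 0" using xi[of 0] T by (simp add: G_def J_def)
  ultimately have "x T \<bullet> (P *v x T) = J T" by (simp add: G_def)
  then show ?thesis using integrable_integral[OF ji] by (simp add: J_def)
qed

section \<open>Square-integrable signals\<close>

text \<open>Membership in \<open>L2\<close> relative to a set, so that truncated signals can be
  treated as signals on \<open>{0..T}\<close>.\<close>

definition square_integrable :: "real set \<Rightarrow> 'n::finite signal \<Rightarrow> bool" where
  "square_integrable S u \<longleftrightarrow> set_borel_measurable lebesgue S u \<and>
     set_integrable lebesgue S (\<lambda>t. (norm (u t))\<^sup>2)"

lemma L2_iff: "u \<in> L2 \<longleftrightarrow> square_integrable {0..} u"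
  by (simp add: L2_def square_integrable_def)

lemma square_integrable_cong:
  assumes "\<And>t. t \<in> S \<Longrightarrow> u t = v t"
  shows "square_integrable S u \<longleftrightarrow> square_integrable S v"
proof -
  have "(\<lambda>t. indicator S t *\<^sub>R u t) = (\<lambda>t. indicator S t *\<^sub>R v t)"
    "(\<lambda>t. indicator S t *\<^sub>R (norm (u t))\<^sup>2) = (\<lambda>t. indicator S t *\<^sub>R (norm (v t))\<^sup>2)"
    using assms by (auto simp: indicator_def fun_eq_iff)
  then show ?thesis
    by (simp only: square_integrable_def set_borel_measurable_def set_integrable_def)
qed

lemma square_integrable_trunc: "square_integrable {0..} (trunc T u) \<longleftrightarrow> square_integrable {0..T} u"
proof -
  have "(\<lambda>t. indicator {0..} t *\<^sub>R trunc T u t) = (\<lambda>t. indicator {0..T} t *\<^sub>R u t)"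
    "(\<lambda>t. indicator {0..} t *\<^sub>R (norm (trunc T u t))\<^sup>2) = (\<lambda>t. indicator {0..T} t *\<^sub>R (norm (u t))\<^sup>2)"
    by (auto simp: indicator_def trunc_def)
  then show ?thesis
    by (simp only: square_integrable_def set_borel_measurable_def set_integrable_def)
qed

lemma sig_inner_trunc: "sig_inner (trunc T u) (trunc T v) = (LINT t:{0..T}|lebesgue. u t \<bullet> v t)"
proof -
  have "(\<lambda>t. indicator {0..} t *\<^sub>R (trunc T u t \<bullet> trunc T v t)) = (\<lambda>t. indicator {0..T} t *\<^sub>R (u t \<bullet> v t))"
    by (auto simp: indicator_def trunc_def)
  then show ?thesis by (simp only: sig_inner_def set_lebesgue_integral_def)
qed

lemma square_integrable_inner:
  assumes u: "square_integrable S u" and v: "square_integrable S v"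
  shows "set_integrable lebesgue S (\<lambda>t. u t \<bullet> v t)"
  unfolding set_integrable_def
proof (rule Bochner_Integration.integrable_bound)
  show "integrable lebesgue (\<lambda>t. indicator S t *\<^sub>R (norm (u t))\<^sup>2 + indicator S t *\<^sub>R (norm (v t))\<^sup>2)"
    using u v by (simp add: square_integrable_def set_integrable_def)
  have "(\<lambda>t. indicator S t *\<^sub>R u t \<bullet> indicator S t *\<^sub>R v t) \<in> borel_measurable lebesgue"
    using u v unfolding square_integrable_def set_borel_measurable_def
    by (intro borel_measurable_inner) auto
  also have "(\<lambda>t. indicator S t *\<^sub>R u t \<bullet> indicator S t *\<^sub>R v t) = (\<lambda>t. indicator S t *\<^sub>R (u t \<bullet> v t))"
    by (auto simp: indicator_def)
  finally show "(\<lambda>t. indicator S t *\<^sub>R (u t \<bullet> v t)) \<in> borel_measurable lebesgue" .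
  have "norm (indicator S t *\<^sub>R (u t \<bullet> v t))
      \<le> norm (indicator S t *\<^sub>R (norm (u t))\<^sup>2 + indicator S t *\<^sub>R (norm (v t))\<^sup>2)" for t
  proof -
    have "\<bar>u t \<bullet> v t\<bar> \<le> norm (u t) * norm (v t)" by (rule Cauchy_Schwarz_ineq2)
    also have "\<dots> \<le> 2 * norm (u t) * norm (v t)" by simp
    also have "\<dots> \<le> (norm (u t))\<^sup>2 + (norm (v t))\<^sup>2" by (rule sum_squares_bound)
    finally show ?thesis by (simp add: indicator_def)
  qed
  then show "AE t in lebesgue. norm (indicator S t *\<^sub>R (u t \<bullet> v t))
      \<le> norm (indicator S t *\<^sub>R (norm (u t))\<^sup>2 + indicator S t *\<^sub>R (norm (v t))\<^sup>2)"
    by simp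
qed

lemma square_integrable_mult:
  fixes M :: "real^'k^'l"
  assumes "square_integrable S u"
  shows "square_integrable S (\<lambda>t. M *v u t)"
proof -
  obtain K where K: "\<And>v. norm (M *v v) \<le> norm v * K"
    using bounded_linear.pos_bounded[OF matrix_vector_mul_bounded_linear[of M]] by blast
  have "(\<lambda>t. M *v (indicator S t *\<^sub>R u t)) \<in> borel_measurable lebesgue"
    by (rule borel_measurable_continuous_on[of "(*v) M"])
      (use assms in \<open>auto intro: linear_continuous_on simp: square_integrable_def set_borel_measurable_def\<close>)
  then have meas: "set_borel_measurable lebesgue S (\<lambda>t. M *v u t)"
    by (simp add: set_borel_measurable_def matrix_vector_mult_scaleR)
  have "set_integrable lebesgue S (\<lambda>t. (norm (M *v u t))\<^sup>2)"
    unfolding set_integrable_def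
  proof (rule Bochner_Integration.integrable_bound)
    show "integrable lebesgue (\<lambda>t. K\<^sup>2 * (indicator S t *\<^sub>R (norm (u t))\<^sup>2))"
      using assms by (simp add: square_integrable_def set_integrable_def)
    have "(\<lambda>t. (norm (indicator S t *\<^sub>R (M *v u t)))\<^sup>2) \<in> borel_measurable lebesgue"
      using meas unfolding set_borel_measurable_def by measurable
    also have "(\<lambda>t. (norm (indicator S t *\<^sub>R (M *v u t)))\<^sup>2) = (\<lambda>t. indicator S t *\<^sub>R (norm (M *v u t))\<^sup>2)"
      by (auto simp: indicator_def)
    finally show "(\<lambda>t. indicator S t *\<^sub>R (norm (M *v u t))\<^sup>2) \<in> borel_measurable lebesgue" .
    have "(norm (M *v u t))\<^sup>2 \<le> K\<^sup>2 * (norm (u t))\<^sup>2" for t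
      using power_mono[OF K[of "u t"], of 2] by (simp add: power_mult_distrib mult.commute)
    then show "AE t in lebesgue. norm (indicator S t *\<^sub>R (norm (M *v u t))\<^sup>2)
        \<le> norm (K\<^sup>2 * (indicator S t *\<^sub>R (norm (u t))\<^sup>2))"
      by (auto simp: indicator_def)
  qed
  with meas show ?thesis by (simp add: square_integrable_def)
qed

lemma square_integrable_add:
  assumes u: "square_integrable S u" and v: "square_integrable S v"
  shows "square_integrable S (\<lambda>t. u t + v t)"
proof -
  have "(\<lambda>t. indicator S t *\<^sub>R u t + indicator S t *\<^sub>R v t) \<in> borel_measurable lebesgue"
    using u v unfolding square_integrable_def set_borel_measurable_def
    by (intro borel_measurable_add) auto
  then have "set_borel_measurable lebesgue S (\<lambda>t. u t + v t)"
    by (simp add: set_borel_measurable_def scaleR_add_right)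
  moreover have "set_integrable lebesgue S (\<lambda>t. (norm (u t))\<^sup>2 + 2 * (u t \<bullet> v t) + (norm (v t))\<^sup>2)"
    using u v square_integrable_inner[OF u v]
    by (intro set_integral_add set_integrable_mult_right) (auto simp: square_integrable_def)
  moreover have "(norm (u t + v t))\<^sup>2 = (norm (u t))\<^sup>2 + 2 * (u t \<bullet> v t) + (norm (v t))\<^sup>2" for t
    by (simp add: power2_norm_eq_inner inner_add_left inner_add_right inner_commute)
  ultimately show ?thesis by (simp add: square_integrable_def)
qed

lemma square_integrable_continuous:
  assumes "continuous_on {a..b} x"
  shows "square_integrable {a..b} x"
proof -
  have "x absolutely_integrable_on {a..b}"
    using assms by (rule absolutely_integrable_continuous_real)
  then have "set_borel_measurable lebesgue {a..b} x"
    unfolding set_integrable_def set_borel_measurable_def by (rule borel_measurable_integrable)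
  moreover have "(\<lambda>t. (norm (x t))\<^sup>2) absolutely_integrable_on {a..b}"
    by (intro absolutely_integrable_continuous_real continuous_intros assms)
  ultimately show ?thesis by (simp add: square_integrable_def)
qed

text \<open>On a bounded interval \<open>1 + (norm (u t))\<^sup>2\<close> is an integrable majorant.
  This makes the velocity of the state absolutely integrable, as the product rule requires.\<close>

lemma square_integrable_imp_absolutely_integrable:
  assumes "square_integrable {a..b} u"
  shows "u absolutely_integrable_on {a..b}"
  unfolding set_integrable_def
proof (rule Bochner_Integration.integrable_bound)
  have "(\<lambda>t. 1::real) absolutely_integrable_on {a..b}"
    by (intro absolutely_integrable_continuous_real continuous_intros)
  then show "integrable lebesgue (\<lambda>t. indicator {a..b} t *\<^sub>R (1::real) + indicator {a..b} t *\<^sub>R (norm (u t))\<^sup>2)"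
    using assms unfolding square_integrable_def set_integrable_def
    by (intro Bochner_Integration.integrable_add) auto
  show "(\<lambda>t. indicator {a..b} t *\<^sub>R u t) \<in> borel_measurable lebesgue"
    using assms by (simp add: square_integrable_def set_borel_measurable_def)
  have "norm (u t) \<le> 1 + (norm (u t))\<^sup>2" for t
    using sum_squares_bound[of 1 "norm (u t)"] norm_ge_zero[of "u t"] unfolding power_one by linarith
  then show "AE t in lebesgue. norm (indicator {a..b} t *\<^sub>R u t)
      \<le> norm (indicator {a..b} t *\<^sub>R (1::real) + indicator {a..b} t *\<^sub>R (norm (u t))\<^sup>2)"
    by (auto simp: indicator_def)
qed

lemma square_integrable_subset:
  assumes "square_integrable S u" "T \<subseteq> S" "T \<in> sets lebesgue"
  shows "square_integrable T u"
proof -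
  have "(\<lambda>t. indicator S t *\<^sub>R u t) \<in> borel_measurable lebesgue"
    using assms(1) unfolding square_integrable_def set_borel_measurable_def by blast
  then have "(\<lambda>t. indicator T t *\<^sub>R (indicator S t *\<^sub>R u t)) \<in> borel_measurable lebesgue"
    by (rule borel_measurable_scaleR[OF borel_measurable_indicator[OF assms(3)]])
  also have "(\<lambda>t. indicator T t *\<^sub>R (indicator S t *\<^sub>R u t)) = (\<lambda>t. indicator T t *\<^sub>R u t)"
    using assms(2) by (auto simp: indicator_def fun_eq_iff)
  finally show ?thesis
    using assms set_integrable_subset unfolding square_integrable_def set_borel_measurable_def by blast
qed

section \<open>Supply rates and membership in the region\<close>

definition supply_rate :: "real \<Rightarrow> real \<Rightarrow> real \<Rightarrow> 'n::finite signal \<Rightarrow> 'n signal \<Rightarrow> real \<Rightarrow> real" where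
  "supply_rate a b c u y t = a * (y t \<bullet> y t) + 2 * b * (u t \<bullet> y t) + c * (u t \<bullet> u t)"

lemma supply_rate_integrable:
  assumes "square_integrable S u" "square_integrable S y"
  shows "set_integrable lebesgue S (supply_rate a b c u y)"
    and "(LINT t:S|lebesgue. supply_rate a b c u y t) =
      a * (LINT t:S|lebesgue. y t \<bullet> y t) + 2 * b * (LINT t:S|lebesgue. u t \<bullet> y t)
        + c * (LINT t:S|lebesgue. u t \<bullet> u t)"
proof -
  note int = square_integrable_inner[OF assms(2) assms(2)] square_integrable_inner[OF assms]
    square_integrable_inner[OF assms(1) assms(1)]
  have i: "set_integrable lebesgue S (\<lambda>t. a * (y t \<bullet> y t))"
    "set_integrable lebesgue S (\<lambda>t. 2 * b * (u t \<bullet> y t))"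
    "set_integrable lebesgue S (\<lambda>t. c * (u t \<bullet> u t))"
    using int by (auto intro: set_integrable_mult_right)
  show "set_integrable lebesgue S (supply_rate a b c u y)"
    unfolding supply_rate_def using i by (intro set_integral_add)
  show "(LINT t:S|lebesgue. supply_rate a b c u y t) =
      a * (LINT t:S|lebesgue. y t \<bullet> y t) + 2 * b * (LINT t:S|lebesgue. u t \<bullet> y t)
        + c * (LINT t:S|lebesgue. u t \<bullet> u t)"
    unfolding supply_rate_def set_integral_add(2)[OF set_integral_add(1)[OF i(1,2)] i(3)]
      set_integral_add(2)[OF i(1,2)] by (simp only: set_integral_mult_right)
qed

lemma sig_inner_nonneg: "0 \<le> sig_inner u u"
  unfolding sig_inner_def set_lebesgue_integral_def
  by (intro Bochner_Integration.integral_nonneg) (simp add: indicator_def)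

lemma sig_norm_power2: "(sig_norm u)\<^sup>2 = sig_inner u u"
  by (simp add: sig_norm_def sig_inner_nonneg)

text \<open>The supply rate with coefficients \<open>p\<^sup>2\<close>, \<open>p * r\<close>,
  \<open>r\<^sup>2\<close> is the squared norm of \<open>p y + r u\<close>, so its integral is
  nonnegative for all \<open>p\<close> and \<open>r\<close>.\<close>

lemma sig_inner_Cauchy_Schwarz:
  assumes u: "u \<in> L2" and y: "y \<in> L2"
  shows "\<bar>sig_inner u y\<bar> \<le> sig_norm u * sig_norm y"
proof -
  have si: "square_integrable {0..} u" "square_integrable {0..} y"
    using u y by (auto simp: L2_iff)
  define U Y I where "U = sig_inner u u" "Y = sig_inner y y" "I = sig_inner u y"
  have nonneg: "0 \<le> a * Y + 2 * b * I + c * U" if "\<And>t. 0 \<le> supply_rate a b c u y t" for a b c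
  proof -
    have "0 \<le> (LINT t:{0..}|lebesgue. supply_rate a b c u y t)"
      unfolding set_lebesgue_integral_def
      by (intro Bochner_Integration.integral_nonneg) (use that in \<open>simp add: indicator_def\<close>)
    then show ?thesis
      by (simp add: supply_rate_integrable(2)[OF si] U_Y_I_def sig_inner_def)
  qed
  have UY: "0 \<le> U" "0 \<le> Y" by (auto simp: U_Y_I_def sig_inner_nonneg)
  have q: "0 \<le> p\<^sup>2 * Y + 2 * (p * r) * I + r\<^sup>2 * U" for p r
  proof (rule nonneg)
    fix t
    have "supply_rate (p\<^sup>2) (p * r) (r\<^sup>2) u y t = (p *\<^sub>R y t + r *\<^sub>R u t) \<bullet> (p *\<^sub>R y t + r *\<^sub>R u t)"
      by (simp add: supply_rate_def inner_add_left inner_add_right inner_commute power2_eq_square algebra_simps)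
    then show "0 \<le> supply_rate (p\<^sup>2) (p * r) (r\<^sup>2) u y t" by simp
  qed
  have "I\<^sup>2 \<le> U * Y"
  proof (cases "Y = 0")
    case True
    have "0 \<le> U - 2 * s * I" for s using q[of "- s" 1] True by simp
    \<comment> \<open>For nonzero \<open>I\<close> this \<open>s\<close> would give the value
      -1.\<close>
    from this[of "(U + 1) / (2 * I)"] have "I = 0" by (cases "I = 0") (auto simp: field_simps)
    then show ?thesis using True by simp
  next
    case False
    \<comment> \<open>The choice \<open>p = I\<close>, \<open>r = - Y\<close> is, up to scale, the
      residual of projecting \<open>u\<close> onto \<open>y\<close>.\<close>
    have "0 \<le> I\<^sup>2 * Y + 2 * (I * (- Y)) * I + (- Y)\<^sup>2 * U" by (rule q)
    also have "\<dots> = Y * (U * Y - I\<^sup>2)" by (simp add: power2_eq_square algebra_simps)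
    finally show ?thesis using False UY by (simp add: zero_le_mult_iff)
  qed
  then have "sqrt (I\<^sup>2) \<le> sqrt (U * Y)" by (rule real_sqrt_le_mono)
  then show ?thesis by (simp add: real_sqrt_mult sig_norm_def U_Y_I_def)
qed

text \<open>Both points have modulus \<open>gain u y\<close> and real part
  \<open>sig_inner u y / (sig_norm u)\<^sup>2\<close>, so the inequality of the region is
  \<open>pos\<close> divided by the squared norm of \<open>u\<close>. Cauchy-Schwarz is what allows
  \<open>cos\<close> to undo \<open>arccos\<close>.\<close>

lemma sg_points_in_region:
  assumes u: "u \<in> L2" and y: "y \<in> L2" and nz: "sig_norm u \<noteq> 0" and z: "z \<in> sg_points u y"
    and pos: "0 \<le> a * sig_inner y y + 2 * b * sig_inner u y + c * sig_inner u u"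
  shows "z \<in> multiplier_region (multiplier a b c)"
proof -
  define \<phi> where "\<phi> = phase u y"
  have nn: "sig_norm u \<ge> 0" "sig_norm y \<ge> 0" by (simp_all add: sig_norm_def sig_inner_nonneg)
  have g: "gain u y \<ge> 0" using nn by (simp add: gain_def)
  have "z = of_real (gain u y) * cis \<phi> \<or> z = of_real (gain u y) * cis (- \<phi>)"
    using z by (auto simp: sg_points_def cis_conv_exp \<phi>_def)
  then have z: "cmod z = gain u y" "Re z = gain u y * cos \<phi>"
    using g by (auto simp: norm_mult)
  have "gain u y * cos \<phi> = sig_inner u y / (sig_norm u)\<^sup>2"
  proof (cases "sig_norm y = 0")
    \<comment> \<open>The phase is 0 by convention, but the gain is 0 as well, so both sides
      vanish.\<close>
    case True
    then have "sig_inner u y = 0" using sig_inner_Cauchy_Schwarz[OF u y] by simp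
    then show ?thesis using True by (simp add: gain_def)
  next
    case False
    then have pos: "sig_norm u * sig_norm y > 0" using nn nz by simp
    then have "\<bar>sig_inner u y / (sig_norm u * sig_norm y)\<bar> \<le> 1"
      using sig_inner_Cauchy_Schwarz[OF u y] by (simp add: abs_divide)
    then have "cos \<phi> = sig_inner u y / (sig_norm u * sig_norm y)"
      using False by (simp add: \<phi>_def phase_def cos_arccos_abs)
    then show ?thesis using False nz by (simp add: gain_def field_simps power2_eq_square)
  qed
  then have "a * (cmod z)\<^sup>2 + 2 * b * Re z + c
      = (a * sig_inner y y + 2 * b * sig_inner u y + c * sig_inner u u) / (sig_norm u)\<^sup>2"
    using nz by (simp add: z gain_def power_divide sig_norm_power2[symmetric] add_divide_distrib)
  also have "\<dots> \<ge> 0" using pos by simp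
  finally show ?thesis by (simp add: multiplier_region_def multiplier_simps)
qed

section \<open>From the state equation to the scaled graphs\<close>

text \<open>The storage \<open>x T \<bullet> (P *v x T)\<close> equals its whole increment since the
  state starts at zero, and it is nonnegative by \<open>pos\<close>. The output is square integrable
  on \<open>{0..T}\<close> because the state is continuous there.\<close>

lemma dissipation_inequality:
  fixes A :: "real^'m^'m" and B :: "real^'n^'m" and C :: "real^'m^'n" and D :: "real^'n^'n"
  assumes lmi: "neg_semidef
             (transpose (block A B (mat 1) 0) ** block 0 P P 0 ** block A B (mat 1) 0
              - varrho C D (multiplier a b c))"
    and P: "transpose P = P" and pos: "\<And>x. 0 \<le> x \<bullet> (P *v x)"
    and sys: "lti A B C D u y" and u: "square_integrable {0..T} u" and T: "0 \<le> T"
  shows "square_integrable {0..T} y" and "0 \<le> (LINT t:{0..T}|lebesgue. supply_rate a b c u y t)"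
proof -
  obtain x where x: "\<And>t. t \<ge> 0 \<Longrightarrow> ((\<lambda>s. A *v x s + B *v u s) has_integral x t) {0..t}"
    and y: "\<And>t. t \<ge> 0 \<Longrightarrow> y t = C *v x t + D *v u t"
    using sys by (auto simp: lti_def)
  let ?w = "\<lambda>s. A *v x s + B *v u s"
  have "continuous_on {0..T} (\<lambda>t. integral {0..t} ?w)"
    using x[OF T] by (intro indefinite_integral_continuous_1) auto
  then have "continuous_on {0..T} x"
    by (rule continuous_on_eq) (use x in \<open>auto simp: integral_unique\<close>)
  then have xs: "square_integrable {0..T} x" by (rule square_integrable_continuous)
  have "square_integrable {0..T} y \<longleftrightarrow> square_integrable {0..T} (\<lambda>t. C *v x t + D *v u t)"
    by (rule square_integrable_cong) (simp add: y)
  then show ys: "square_integrable {0..T} y"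
    using xs u by (simp add: square_integrable_add square_integrable_mult)
  have "?w absolutely_integrable_on {0..T}"
    using xs u by (intro square_integrable_imp_absolutely_integrable square_integrable_add square_integrable_mult)
  then have V: "((\<lambda>t. 2 * (?w t \<bullet> (P *v x t))) has_integral x T \<bullet> (P *v x T)) {0..T}"
    using x T P by (intro has_integral_quadratic_form) auto
  have "(supply_rate a b c u y has_integral (LINT t:{0..T}|lebesgue. supply_rate a b c u y t)) {0..T}"
    by (rule has_integral_set_lebesgue[OF supply_rate_integrable(1)[OF u ys]])
  with V have "x T \<bullet> (P *v x T) \<le> (LINT t:{0..T}|lebesgue. supply_rate a b c u y t)"
  proof (rule has_integral_le)
    fix t assume "t \<in> {0..T}"
    then show "2 * (?w t \<bullet> (P *v x t)) \<le> supply_rate a b c u y t"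
      using lmi_dissipation[OF lmi P, of "x t" "u t"] by (simp add: y supply_rate_def)
  qed
  then show "0 \<le> (LINT t:{0..T}|lebesgue. supply_rate a b c u y t)" using pos[of "x T"] by linarith
qed

text \<open>Monotone convergence along integer horizons.\<close>

lemma square_integrable_limit:
  fixes y :: "'n::finite signal"
  assumes y: "\<And>T. 0 \<le> T \<Longrightarrow> square_integrable {0..T} y"
    and bound: "\<And>T. 0 \<le> T \<Longrightarrow> (LINT t:{0..T}|lebesgue. y t \<bullet> y t) \<le> K"
  shows "square_integrable {0..} y"
proof -
  have ev: "eventually (\<lambda>n. indicator {0..real n} t = (indicator {0..} t :: real)) sequentially" for t
    using eventually_ge_at_top[of "nat \<lceil>t\<rceil>"]
    by eventually_elim (auto simp: indicator_def nat_le_iff ceiling_le_iff)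
  have "(\<lambda>t. indicator {0..} t *\<^sub>R y t) \<in> borel_measurable lebesgue"
  proof (rule borel_measurable_LIMSEQ_metric)
    show "(\<lambda>t. indicator {0..real n} t *\<^sub>R y t) \<in> borel_measurable lebesgue" for n
      using y[of "real n"] by (simp add: square_integrable_def set_borel_measurable_def)
    show "(\<lambda>n. indicator {0..real n} t *\<^sub>R y t) \<longlonglongrightarrow> indicator {0..} t *\<^sub>R y t" for t
      by (rule tendsto_eventually) (use ev[of t] in eventually_elim, simp)
  qed
  then have meas: "set_borel_measurable lebesgue {0..} y" by (simp add: set_borel_measurable_def)
  define f where "f n t = indicator {0..real n} t *\<^sub>R (norm (y t))\<^sup>2" for n :: nat and t
  have int: "integrable lebesgue (f n)" for n
    using y[of "real n"] unfolding square_integrable_def set_integrable_def f_def by simp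
  have mono: "f m t \<le> f n t" if "m \<le> n" for m n t
    using that by (auto simp: f_def indicator_def)
  have "incseq (\<lambda>n. integral\<^sup>L lebesgue (f n))"
    by (intro monoI integral_mono int mono)
  moreover have "\<forall>n. integral\<^sup>L lebesgue (f n) \<le> K"
    using bound unfolding f_def set_lebesgue_integral_def power2_norm_eq_inner by simp
  ultimately obtain L where L: "(\<lambda>n. integral\<^sup>L lebesgue (f n)) \<longlonglongrightarrow> L"
    by (rule incseq_convergent)
  have "integrable lebesgue (\<lambda>t. indicator {0..} t *\<^sub>R (norm (y t))\<^sup>2)"
  proof (rule integral_monotone_convergence_nonneg(1)[OF int _ _ _ L])
    show "AE t in lebesgue. mono (\<lambda>n. f n t)" by (simp add: mono_def mono)
    show "AE t in lebesgue. 0 \<le> f n t" for n by (simp add: f_def)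
    have "(\<lambda>n. f n t) \<longlonglongrightarrow> indicator {0..} t *\<^sub>R (norm (y t))\<^sup>2" for t
      by (rule tendsto_eventually) (use ev[of t] in eventually_elim, simp add: f_def)
    then show "AE t in lebesgue. (\<lambda>n. f n t) \<longlonglongrightarrow> indicator {0..} t *\<^sub>R (norm (y t))\<^sup>2" by simp
    have "(\<lambda>t. (norm (indicator {0..} t *\<^sub>R y t))\<^sup>2) \<in> borel_measurable lebesgue"
      using meas unfolding set_borel_measurable_def by measurable
    also have "(\<lambda>t. (norm (indicator {0..} t *\<^sub>R y t))\<^sup>2) = (\<lambda>t. indicator {0..} t *\<^sub>R (norm (y t))\<^sup>2)"
      by (auto simp: indicator_def)
    finally show "(\<lambda>t. indicator {0..} t *\<^sub>R (norm (y t))\<^sup>2) \<in> borel_measurable lebesgue" .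
  qed
  with meas show ?thesis by (simp add: square_integrable_def set_integrable_def)
qed

text \<open>The relation \<open>lti\<close> does not itself place the output of an \<open>L2\<close>
  input in \<open>L2\<close>. Half of the negative term in \<open>y\<close> absorbs the cross term;
  the other half bounds the energy of \<open>y\<close> uniformly in \<open>T\<close>.\<close>

lemma output_square_integrable:
  fixes u y :: "'n::finite signal"
  assumes u: "square_integrable {0..} u" and a: "a < 0"
    and y: "\<And>T. 0 \<le> T \<Longrightarrow> square_integrable {0..T} y"
    and nonneg: "\<And>T. 0 \<le> T \<Longrightarrow> 0 \<le> (LINT t:{0..T}|lebesgue. supply_rate a b c u y t)"
  shows "square_integrable {0..} y"
proof (rule square_integrable_limit[OF y])
  \<comment> \<open>The second summand is what completing the square in \<open>a y + 2 b u\<close>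
    costs in terms of \<open>u\<close>.\<close>
  define k where "k = \<bar>c\<bar> + 2 * b\<^sup>2 / (- a)"
  have k: "k \<ge> 0" unfolding k_def using a by (intro add_nonneg_nonneg divide_nonneg_pos) auto
  fix T :: real assume T: "0 \<le> T"
  have uT: "square_integrable {0..T} u"
    using u by (rule square_integrable_subset) auto
  have le: "supply_rate a b c u y t \<le> supply_rate (a / 2) 0 k u y t" for t
  proof -
    have "0 \<le> (a *\<^sub>R y t + (2 * b) *\<^sub>R u t) \<bullet> (a *\<^sub>R y t + (2 * b) *\<^sub>R u t) / (- 2 * a)"
      using a by (intro divide_nonneg_pos) auto
    also have "\<dots> = - (a / 2) * (y t \<bullet> y t) - 2 * b * (u t \<bullet> y t) + 2 * b\<^sup>2 / (- a) * (u t \<bullet> u t)"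
      using a by (simp add: inner_add_left inner_add_right inner_commute power2_eq_square field_simps)
    finally have "2 * b * (u t \<bullet> y t) \<le> - (a / 2) * (y t \<bullet> y t) + 2 * b\<^sup>2 / (- a) * (u t \<bullet> u t)"
      by linarith
    moreover have "c * (u t \<bullet> u t) \<le> \<bar>c\<bar> * (u t \<bullet> u t)" by (intro mult_right_mono) auto
    ultimately show ?thesis by (simp add: supply_rate_def k_def algebra_simps)
  qed
  have "0 \<le> (LINT t:{0..T}|lebesgue. supply_rate a b c u y t)" using nonneg[OF T] .
  also have "\<dots> \<le> (LINT t:{0..T}|lebesgue. supply_rate (a / 2) 0 k u y t)"
    by (rule set_integral_mono[OF supply_rate_integrable(1)[OF uT y[OF T]] supply_rate_integrable(1)[OF uT y[OF T]] le])
  also have "\<dots> = a / 2 * (LINT t:{0..T}|lebesgue. y t \<bullet> y t) + k * (LINT t:{0..T}|lebesgue. u t \<bullet> u t)"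
    by (simp add: supply_rate_integrable(2)[OF uT y[OF T]])
  also have "(LINT t:{0..T}|lebesgue. u t \<bullet> u t) \<le> (LINT t:{0..}|lebesgue. u t \<bullet> u t)"
    unfolding set_lebesgue_integral_def
    using square_integrable_inner[OF u u] square_integrable_inner[OF uT uT]
    by (intro integral_mono) (auto simp: set_integrable_def indicator_def)
  finally have "- a / 2 * (LINT t:{0..T}|lebesgue. y t \<bullet> y t) \<le> k * (LINT t:{0..}|lebesgue. u t \<bullet> u t)"
    using k by (simp add: mult_left_mono)
  then show "(LINT t:{0..T}|lebesgue. y t \<bullet> y t) \<le> k * (LINT t:{0..}|lebesgue. u t \<bullet> u t) / (- a / 2)"
    using a by (simp add: field_simps)
qed

theorem corollary1:
  fixes A :: "real^'m^'m" and B :: "real^'n^'m" and C :: "real^'m^'n" and D :: "real^'n^'n"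
    and a b c :: real
  assumes "L2_stable A B C D"
    and "stabilizable A B"
    and "detectable A C"
    and "positive_negative (multiplier a b c)"
    and "\<exists>P :: real^'m^'m. transpose P = P \<and>
           neg_semidef
             (transpose (block A B (mat 1) 0) ** block 0 P P 0 ** block A B (mat 1) 0
              - varrho C D (multiplier a b c))"
  shows "SG (lti A B C D) \<subseteq> multiplier_region (multiplier a b c) \<and>
         SGe (lti A B C D) \<subseteq> multiplier_region (multiplier a b c)"
proof -
  have a: "a < 0" using assms(4) by (auto simp: positive_negative_def multiplier_simps)
  obtain P :: "real^'m^'m" where P: "transpose P = P"
    and lmi: "neg_semidef
             (transpose (block A B (mat 1) 0) ** block 0 P P 0 ** block A B (mat 1) 0
              - varrho C D (multiplier a b c))"
    using assms(5) by blast
  have pos: "0 \<le> x \<bullet> (P *v x)" for x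
  proof (rule hurwitz_lyapunov_nonneg[OF hurwitz_if_L2_stable[OF assms(1-3)] P])
    fix x
    have "2 * ((A *v x) \<bullet> (P *v x)) \<le> a * ((C *v x) \<bullet> (C *v x))"
      using lmi_dissipation[OF lmi P, of x 0] by simp
    also have "\<dots> \<le> 0" using a by (simp add: mult_nonpos_nonneg)
    finally show "x \<bullet> (P *v (A *v x)) \<le> 0"
      using symmetric_inner[OF P, of x "A *v x"] by simp
  qed
  note dissipation = dissipation_inequality[OF lmi P pos]
  have "z \<in> multiplier_region (multiplier a b c)"
    if "u \<in> L2e" "lti A B C D u y" "T > 0" "sig_norm (trunc T u) \<noteq> 0"
      "z \<in> sg_points (trunc T u) (trunc T y)" for z u y T
  proof -
    have u: "square_integrable {0..T} u"
      using that(1,3) by (simp add: L2e_def L2_iff square_integrable_trunc)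
    note d = dissipation[OF that(2) u less_imp_le[OF that(3)]]
    show ?thesis
    proof (rule sg_points_in_region[OF _ _ that(4,5)])
      show "0 \<le> a * sig_inner (trunc T y) (trunc T y) + 2 * b * sig_inner (trunc T u) (trunc T y)
          + c * sig_inner (trunc T u) (trunc T u)"
        using d(2) by (simp add: sig_inner_trunc supply_rate_integrable(2)[OF u d(1)])
    qed (use u d(1) in \<open>simp_all add: L2_iff square_integrable_trunc\<close>)
  qed
  moreover have "z \<in> multiplier_region (multiplier a b c)"
    if "u \<in> L2" "sig_norm u \<noteq> 0" "lti A B C D u y" "z \<in> sg_points u y" for z u y
  proof -
    have u: "square_integrable {0..} u" using that(1) by (simp add: L2_iff)
    then have uT: "square_integrable {0..T} u" for T
      by (rule square_integrable_subset) auto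
    note d = dissipation[OF that(3) uT]
    have y: "square_integrable {0..} y"
      using output_square_integrable[OF u a d] by blast
    have "((\<lambda>T. LINT t:{0..T}|lebesgue. supply_rate a b c u y t)
        \<longlongrightarrow> (LINT t:{0..}|lebesgue. supply_rate a b c u y t)) at_top"
      by (rule tendsto_set_lebesgue_integral_at_top) (auto intro: supply_rate_integrable u y)
    then have "0 \<le> (LINT t:{0..}|lebesgue. supply_rate a b c u y t)"
      by (rule tendsto_lowerbound) (use d(2) in \<open>auto intro: eventually_at_top_linorderI[of 0]\<close>)
    then show ?thesis
      using that u y supply_rate_integrable(2)[OF u y]
      by (intro sg_points_in_region[of u y]) (simp_all add: L2_iff sig_inner_def)
  qed
  ultimately show ?thesis by (auto simp: SG_def SGe_def)
qed

end
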